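(* Consider the discrete reconstruction equation $R_{k+1}=R_k\,\mathrm{cay}(\epsilon\hat\omega_k)$ in $SO(3)$ and the metric $\mathrm{dist}(R_1,R_2)=|I-R_1R_2^T|$ on $SO(3)$. Then a $(p,s)$ integrator $\{(\hat\omega_k,\lambda_k)\}_{k=0}^N\subset\mathfrak{so}(3)\times\mathbb R$ of the Suslov problem ($p,s\ge0$) generates, through this reconstruction and $v_{R_k}=R_k\hat\omega_k$, a $(1,s)$ integrator $\{(v_{R_k},\lambda_k)\}_{k=0}^N$ of the unreduced nonholonomic equations on $SO(3)$.
   Context: Notation: $\hat\cdot:\mathbb R^3\to\mathfrak{so}(3)$ is the standard isomorphism with $\hat\omega x=\omega\times x$. The distance on $\mathfrak{so}(3)$ is $|\hat\xi-\hat\eta|=(\hat\xi-\hat\eta,\hat\xi-\hat\eta)_e^{1/2}$ with $(\hat\xi,\hat\eta)_e=\frac12\mathrm{trace}(\hat\xi^T\hat\eta)$, i.e. the Euclidean distance in $\mathbb R^3$. On $SO(3)$, $\mathrm{dist}(R_1,R_2)=|I-R_1R_2^T|$, where $|A|^2=\sum_{ij}|A_{ij}|^2$ and $I$ is the identity. The Cayley map $\mathrm{cay}:\mathfrak{so}(3)\to SO(3)$ is $\mathrm{cay}(\hat\omega)=(I-\frac{\hat\omega}2)^{-1}(I+\frac{\hat\omega}2)$. The step size is $\epsilon>0$. Suslov problem: with symmetric positive definite inertia tensor $\mathbb I=(\mathbb I_{ij})$, reduced Lagrangian $l(\hat\omega)=\frac12\langle\mathbb I\omega,\omega\rangle$ and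 $e_3=(0,0,1)$, the equations are $\mathbb I\dot\omega=\mathbb I\omega\times\omega+\lambda e_3$, $\omega_3=0$, with solutions $(\omega(t),\lambda^{\rm red}(t))$. The unreduced system on $SO(3)$ is the Lagrange-d'Alembert system with left-invariant Lagrangian $L(R,\dot R)=l(R^{-1}\dot R)$ and left-invariant constraint distribution $D_R=\{R\hat\omega:\omega_3=0\}$, with multiplier $\lambda^{\rm unr}$ taken with respect to the annihilating one-form $\mu(R)=\ell^*_{R^{-1}}e_3$ ($\ell$ = left translation); its solutions $(R(t),v_{R(t)})$ satisfy $v_{R(t)}=\dot R=R\hat\omega$ with $\omega$ a solution of the Suslov problem. A $(p,s)$ integrator of the Suslov problem, $p,s\ge0$, is a sequence $\{(\hat\omega_k,\lambda_k)\}_{k=0}^N$ with $|\hat\omega(t_k+\epsilon)-\hat\omega_{k+1}|\sim O(\epsilon^{p+1})$ and $|\lambda^{\rm red}(t_k+\epsilon)-\lambda_{k+1}|\sim O(\epsilon^{s+1})$. A $(p,s)$ integrator of the unreduced equations, $p,s\ge0$, is a sequence $\{(v_{R_k},\lambda_k)\}_{k=0}^N$, $v_{R_k}\in T_{R_k}SO(3)$, with $\mathrm{dist}(R(t_k+\epsilon),R_{k+1})\sim O(\epsilon^{r+1})$, $|R(t_k+\epsilon)^{-1}v_{R(t_k+\epsilon)}-R_{k+1}^{-1}v_{R_{k+1}}|\sim O(\epsilon^{q+1})$, $\min(r,q)=p$, and $|\lambda^{\rm unr}(t_k+\epsilon)-\lambda_{k+1}|\sim O(\epsilon^{s+1})$.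 All errors are local (one-step) errors: the exact solution satisfies $\omega(t_k)=\omega_k$ and $R(t_k)=R_k$.
   Formalization: The generated integrator is shown to be of order (min(1,p), s): this is (1,s) for p≥1, but (0,s) for p=0, where the claim fails (inertia tensor I, ω_k=kε e_1, λ_k=0 is a (0,s) integrator whose velocity error is ε, not O(ε²)). *)

theory Defs
  imports "HOL-Analysis.Analysis"
begin

definition hat :: "real^3 \<Rightarrow> real^3^3" where
  "hat w = matrix (\<lambda>x. cross3 w x)"

definition so3 :: "(real^3^3) set" where
  "so3 = {A. transpose A = - A}"

text \<open>Inverse of the isomorphism \<^const>\<open>hat\<close>; it is only ever applied to elements of so(3).\<close>

definition vee :: "real^3^3 \<Rightarrow> real^3" where
  "vee A = inv hat A"

definition so3_norm :: "real^3^3 \<Rightarrow> real" where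
  "so3_norm A = sqrt (1/2 * trace (transpose A ** A))"

definition SO3 :: "(real^3^3) set" where
  "SO3 = {R. rotation_matrix R}"

definition tangent_SO3 :: "real^3^3 \<Rightarrow> (real^3^3) set" where
  "tangent_SO3 R = {R ** A | A. A \<in> so3}"

text \<open>\<^const>\<open>norm\<close> on \<^typ>\<open>real^3^3\<close> is the square root of the sum of the squared entries.\<close>

definition SO3_dist :: "real^3^3 \<Rightarrow> real^3^3 \<Rightarrow> real" where
  "SO3_dist R\<^sub>1 R\<^sub>2 = norm (mat 1 - R\<^sub>1 ** transpose R\<^sub>2)"

definition cay :: "real^3^3 \<Rightarrow> real^3^3" where
  "cay A = matrix_inv (mat 1 - (1/2) *\<^sub>R A) ** (mat 1 + (1/2) *\<^sub>R A)"

definition e3 :: "real^3" where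
  "e3 = axis 3 1"

definition inertia_tensor :: "real^3^3 \<Rightarrow> bool" where
  "inertia_tensor J \<longleftrightarrow> transpose J = J \<and> (\<forall>x. x \<noteq> 0 \<longrightarrow> (J *v x) \<bullet> x > 0)"


subsection \<open>The Suslov problem\<close>

definition suslov_solution :: "real^3^3 \<Rightarrow> (real \<Rightarrow> real^3) \<Rightarrow> (real \<Rightarrow> real) \<Rightarrow> bool" where
  "suslov_solution J w lam \<longleftrightarrow>
     (\<forall>t. w t $ 3 = 0 \<and>
          (\<exists>w'. (w has_vector_derivative w') (at t) \<and>
                J *v w' = cross3 (J *v w t) (w t) + lam t *\<^sub>R e3))"


subsection \<open>The unreduced system on SO(3)\<close>

definition reduced_lagrangian :: "real^3^3 \<Rightarrow> real^3^3 \<Rightarrow> real" where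
  "reduced_lagrangian J A = 1/2 * ((J *v vee A) \<bullet> vee A)"

definition lagrangian :: "real^3^3 \<Rightarrow> real^3^3 \<Rightarrow> real^3^3 \<Rightarrow> real" where
  "lagrangian J R V = reduced_lagrangian J (matrix_inv R ** V)"

definition constraint_distribution :: "real^3^3 \<Rightarrow> (real^3^3) set" where
  "constraint_distribution R = {R ** hat w | w. w $ 3 = 0}"

definition annihilator_form :: "real^3^3 \<Rightarrow> real^3^3 \<Rightarrow> real" where
  "annihilator_form R V = e3 \<bullet> vee (matrix_inv R ** V)"

definition C1 :: "('a::real_normed_vector \<Rightarrow> 'b::real_normed_vector) \<Rightarrow> bool" where
  "C1 f \<longleftrightarrow> (\<exists>f'. (\<forall>x. (f has_derivative blinfun_apply (f' x)) (at x)) \<and> continuous_on UNIV f')"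

definition C2 :: "('a::real_normed_vector \<Rightarrow> 'b::real_normed_vector) \<Rightarrow> bool" where
  "C2 f \<longleftrightarrow> (\<exists>f'. (\<forall>x. (f has_derivative blinfun_apply (f' x)) (at x)) \<and> C1 f')"

text \<open>The first argument of \<open>\<Gamma>\<close> is the deformation parameter, the second one is time.\<close>

definition fixed_endpoint_variation ::
    "(real \<Rightarrow> real^3^3) \<Rightarrow> real \<Rightarrow> real \<Rightarrow> (real \<Rightarrow> real \<Rightarrow> real^3^3) \<Rightarrow> bool" where
  "fixed_endpoint_variation R a b \<Gamma> \<longleftrightarrow>
     C2 (\<lambda>(u, t). \<Gamma> u t) \<and> (\<forall>u t. \<Gamma> u t \<in> SO3) \<and>
     (\<forall>t. \<Gamma> 0 t = R t) \<and> (\<forall>u. \<Gamma> u a = R a \<and> \<Gamma> u b = R b)"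

definition action ::
    "real^3^3 \<Rightarrow> real \<Rightarrow> real \<Rightarrow> (real \<Rightarrow> real^3^3) \<Rightarrow> real" where
  "action J a b R = integral {a..b} (\<lambda>t. lagrangian J (R t) (vector_derivative R (at t)))"

text \<open>
  The Lagrange-d'Alembert principle with multiplier: the curve satisfies the constraint, and for
  every variation with fixed endpoints the variation of the action and the virtual work of the
  constraint force \<open>lam \<cdot> \<mu>\<close> add up to zero. In coordinates, after integration by parts, this
  is \<open>d/dt (\<partial>L/\<partial>q') - \<partial>L/\<partial>q = lam \<mu>(q)\<close>, so the sign of the multiplier is the one of
  \<^const>\<open>suslov_solution\<close>. Variations are not required to respect the constraint: the multiplier
  accounts for the directions outside the distribution. Continuity of the multiplier makes its
  pointwise values meaningful.
\<close>

definition unreduced_solution ::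
    "real^3^3 \<Rightarrow> (real \<Rightarrow> real^3^3) \<Rightarrow> (real \<Rightarrow> real^3^3) \<Rightarrow> (real \<Rightarrow> real) \<Rightarrow> bool" where
  "unreduced_solution J R V lam \<longleftrightarrow>
     (\<forall>t. R t \<in> SO3 \<and> (R has_vector_derivative V t) (at t) \<and>
          V t \<in> constraint_distribution (R t)) \<and>
     V C1_differentiable_on UNIV \<and> continuous_on UNIV lam \<and>
     (\<forall>a b \<Gamma>. a < b \<longrightarrow> fixed_endpoint_variation R a b \<Gamma> \<longrightarrow>
        ((\<lambda>u. action J a b (\<Gamma> u)) has_real_derivative
           - integral {a..b} (\<lambda>t. lam t *
                annihilator_form (R t) (vector_derivative (\<lambda>u. \<Gamma> u t) (at 0)))) (at 0))"


subsection \<open>Integrators\<close>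

text \<open>
  The estimates are asymptotic in the step size, so an integrator is a family of finite sequences:
  \<open>w \<epsilon> k\<close>, \<open>R \<epsilon> k\<close>, \<open>v \<epsilon> k\<close>, \<open>lam \<epsilon> k\<close> for \<open>k \<le> N \<epsilon>\<close> are the terms of the sequence with step
  size \<open>\<epsilon>\<close>, attached to the times \<open>t\<^sub>k = k \<epsilon>\<close>. All the sequences start at the same initial
  state. The number of steps may depend on \<open>\<epsilon>\<close> as long as the total time stays bounded;
  constant \<open>N\<close> is included.
\<close>

definition bounded_horizon :: "(real \<Rightarrow> nat) \<Rightarrow> bool" where
  "bounded_horizon N \<longleftrightarrow> (\<exists>T. \<forall>\<^sub>F \<epsilon> in at_right 0. real (N \<epsilon>) * \<epsilon> \<le> T)"

text \<open>The one-step errors \<open>err \<epsilon> k\<close>, \<open>k < N \<epsilon>\<close>, are \<open>O(\<epsilon>^n)\<close>, uniformly in \<open>k\<close>.\<close>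

definition error_O :: "nat \<Rightarrow> (real \<Rightarrow> nat) \<Rightarrow> (real \<Rightarrow> nat \<Rightarrow> real) \<Rightarrow> bool" where
  "error_O n N err \<longleftrightarrow> (\<exists>C. \<forall>\<^sub>F \<epsilon> in at_right 0. \<forall>k < N \<epsilon>. \<bar>err \<epsilon> k\<bar> \<le> C * \<epsilon> ^ n)"

text \<open>
  \<open>W \<epsilon> k\<close>, \<open>\<Lambda> \<epsilon> k\<close> is the exact solution that passes at time \<open>t\<^sub>k\<close> through the \<open>k\<close>-th term
  of the sequence. It exists if and only if that term satisfies the constraint, and is then unique.
\<close>

definition suslov_integrator ::
    "real^3^3 \<Rightarrow> (real \<Rightarrow> nat) \<Rightarrow> nat \<Rightarrow> nat \<Rightarrow>
     (real \<Rightarrow> nat \<Rightarrow> real^3) \<Rightarrow> (real \<Rightarrow> nat \<Rightarrow> real) \<Rightarrow> bool" where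
  "suslov_integrator J N p s w lam \<longleftrightarrow>
     (\<exists>w0. \<forall>\<epsilon>>0. w \<epsilon> 0 = w0) \<and>
     (\<forall>\<epsilon>>0. \<forall>k < N \<epsilon>. w \<epsilon> k $ 3 = 0) \<and>
     (\<forall>W \<Lambda>.
        (\<forall>\<epsilon>>0. \<forall>k < N \<epsilon>. suslov_solution J (W \<epsilon> k) (\<Lambda> \<epsilon> k) \<and> W \<epsilon> k (real k * \<epsilon>) = w \<epsilon> k) \<longrightarrow>
        error_O (p + 1) N
          (\<lambda>\<epsilon> k. so3_norm (hat (W \<epsilon> k (real k * \<epsilon> + \<epsilon>)) - hat (w \<epsilon> (Suc k)))) \<and>
        error_O (s + 1) N (\<lambda>\<epsilon> k. \<Lambda> \<epsilon> k (real k * \<epsilon> + \<epsilon>) - lam \<epsilon> (Suc k)))"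

definition unreduced_integrator ::
    "real^3^3 \<Rightarrow> (real \<Rightarrow> nat) \<Rightarrow> nat \<Rightarrow> nat \<Rightarrow>
     (real \<Rightarrow> nat \<Rightarrow> real^3^3) \<Rightarrow> (real \<Rightarrow> nat \<Rightarrow> real^3^3) \<Rightarrow> (real \<Rightarrow> nat \<Rightarrow> real) \<Rightarrow> bool" where
  "unreduced_integrator J N p s R v lam \<longleftrightarrow>
     (\<exists>R0 v0. \<forall>\<epsilon>>0. R \<epsilon> 0 = R0 \<and> v \<epsilon> 0 = v0) \<and>
     (\<forall>\<epsilon>>0. \<forall>k \<le> N \<epsilon>. R \<epsilon> k \<in> SO3 \<and> v \<epsilon> k \<in> tangent_SO3 (R \<epsilon> k)) \<and>
     (\<forall>\<epsilon>>0. \<forall>k < N \<epsilon>. v \<epsilon> k \<in> constraint_distribution (R \<epsilon> k)) \<and>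
     (\<exists>r q. min r q = p \<and>
       (\<forall>X V \<Lambda>.
          (\<forall>\<epsilon>>0. \<forall>k < N \<epsilon>. unreduced_solution J (X \<epsilon> k) (V \<epsilon> k) (\<Lambda> \<epsilon> k) \<and>
              X \<epsilon> k (real k * \<epsilon>) = R \<epsilon> k \<and> V \<epsilon> k (real k * \<epsilon>) = v \<epsilon> k) \<longrightarrow>
          error_O (r + 1) N
            (\<lambda>\<epsilon> k. SO3_dist (X \<epsilon> k (real k * \<epsilon> + \<epsilon>)) (R \<epsilon> (Suc k))) \<and>
          error_O (q + 1) N
            (\<lambda>\<epsilon> k. so3_norm (matrix_inv (X \<epsilon> k (real k * \<epsilon> + \<epsilon>)) ** V \<epsilon> k (real k * \<epsilon> + \<epsilon>)
                            - matrix_inv (R \<epsilon> (Suc k)) ** v \<epsilon> (Suc k))) \<and>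
          error_O (s + 1) N (\<lambda>\<epsilon> k. \<Lambda> \<epsilon> k (real k * \<epsilon> + \<epsilon>) - lam \<epsilon> (Suc k))))"

end

theory Submission
  imports Defs
begin

text \<open>
  Along a solution of the Lagrange-d'Alembert principle, the variations obtained by rotating the
  curve about a body axis \<open>e\<^sub>i\<close> through the angle \<open>u (t - a) (b - t)\<close> show that the body angular
  velocity solves the Suslov problem with the same multiplier. So the velocity and multiplier errors
  of the two integrators coincide, and only the reconstruction error remains. It is
  \<open>O(\<epsilon>\<^sup>2)\<close> because (hats omitted) both \<open>X(t\<^sub>k + \<epsilon>)\<close> and \<open>R\<^sub>k cay(\<epsilon> \<omega>\<^sub>k)\<close> equal
  \<open>R\<^sub>k (I + \<epsilon> \<omega>\<^sub>k) + O(\<epsilon>\<^sup>2)\<close>. These estimates are uniform in \<open>k\<close> because the energy,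
  conserved by the exact flow, grows by at most a factor \<open>1 + O(\<epsilon>)\<close> per numerical step.
\<close>

subsection \<open>Functions of class \<open>C\<^sup>1\<close> and \<open>C\<^sup>2\<close>\<close>

lemma C1_I:
  "(\<And>x. (f has_derivative blinfun_apply (f' x)) (at x)) \<Longrightarrow> continuous_on UNIV f' \<Longrightarrow> C1 f"
  unfolding C1_def by (intro exI[of _ f']) auto

lemma C2_I:
  "(\<And>x. (f has_derivative blinfun_apply (f' x)) (at x)) \<Longrightarrow> C1 f' \<Longrightarrow> C2 f"
  unfolding C2_def by (intro exI[of _ f']) auto

lemma C1_bounded_linear:
  assumes "bounded_linear L" shows "C1 L"
  unfolding C1_def
  by (rule exI[of _ "\<lambda>_. Blinfun L"])
     (auto simp: bounded_linear_Blinfun_apply assms bounded_linear_imp_has_derivative)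

lemma C1_const: "C1 (\<lambda>x::'a::real_normed_vector. c::'b::real_normed_vector)"
  unfolding C1_def by (rule exI[of _ "\<lambda>_. 0"]) (auto simp: zero_blinfun.rep_eq)

lemma C1_add:
  assumes "C1 f" "C1 g" shows "C1 (\<lambda>x. f x + g x)"
proof -
  from assms obtain f' g' where
    "\<And>x. (f has_derivative blinfun_apply (f' x)) (at x)" "continuous_on UNIV f'"
    "\<And>x. (g has_derivative blinfun_apply (g' x)) (at x)" "continuous_on UNIV g'"
    unfolding C1_def by blast
  then show ?thesis unfolding C1_def
    by (intro exI[of _ "\<lambda>x. f' x + g' x"])
       (auto simp: plus_blinfun.rep_eq intro!: derivative_intros continuous_intros)
qed

lemma C1_continuous: "C1 f \<Longrightarrow> continuous_on UNIV f"
  unfolding C1_def by (meson has_derivative_continuous continuous_at_imp_continuous_on)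

lemma C1_compose:
  assumes "C1 f" "C1 g" shows "C1 (\<lambda>x. f (g x))"
proof -
  from assms obtain f' g' where
    d: "\<And>x. (f has_derivative blinfun_apply (f' x)) (at x)" "continuous_on UNIV f'"
    "\<And>x. (g has_derivative blinfun_apply (g' x)) (at x)" "continuous_on UNIV g'"
    unfolding C1_def by blast
  have "((\<lambda>x. f (g x)) has_derivative blinfun_apply (f' (g x) o\<^sub>L g' x)) (at x)" for x
    using has_derivative_compose[OF d(3) d(1)] by (simp add: blinfun_compose.rep_eq comp_def)
  moreover have "continuous_on UNIV (\<lambda>x. f' (g x) o\<^sub>L g' x)"
    by (intro continuous_intros d(4) continuous_on_compose2[OF d(2)] C1_continuous assms) auto
  ultimately show ?thesis by (rule C1_I)
qed

text \<open>Partial application, viewed as an operator, depends linearly and boundedly on the fixed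
  argument, so the coefficients in the product rule are as regular as the factors.
  \<open>Blinfun\<close> is specified only on bounded linear maps; \<open>ap\<close> records that
  this is the case here.\<close>

lemma bounded_linear_Blinfun_left:
  assumes "bounded_bilinear p"
  shows "bounded_linear (\<lambda>a. Blinfun (p a))"
proof -
  interpret bounded_bilinear p by fact
  obtain K where K: "0 \<le> K" "\<And>a b. norm (p a b) \<le> norm a * norm b * K"
    using nonneg_bounded by blast
  have ap: "blinfun_apply (Blinfun (p a)) = p a" for a
    by (simp add: bounded_linear_Blinfun_apply bounded_linear_right)
  show ?thesis
  proof (rule bounded_linear_intro[of _ K])
    show "norm (Blinfun (p x)) \<le> norm x * K" for x
      by (rule norm_blinfun_bound) (use K in \<open>auto simp: ap ac_simps\<close>)
  qed (auto intro!: blinfun_eqI simp: ap blinfun.add_left blinfun.scaleR_left add_left scaleR_left)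
qed

text \<open>The product rule is phrased with operator composition so that the derivative is again a
  sum of bilinear expressions; this lets \<open>C2_bilinear\<close> fall back on
  \<open>C1_bilinear\<close>.\<close>

lemma has_derivative_bilinear:
  assumes "bounded_bilinear p" "(f has_derivative blinfun_apply f') (at x)" "(g has_derivative blinfun_apply g') (at x)"
  shows "((\<lambda>x. p (f x) (g x)) has_derivative
    blinfun_apply ((Blinfun (p (f x)) o\<^sub>L g') + (Blinfun (\<lambda>a. p a (g x)) o\<^sub>L f'))) (at x)"
proof -
  interpret bounded_bilinear p by fact
  show ?thesis
    using FDERIV[OF assms(2,3)]
    by (simp add: plus_blinfun.rep_eq blinfun_compose.rep_eq comp_def
      bounded_linear_Blinfun_apply bounded_linear_right bounded_linear_left)
qed

lemma C1_bilinear: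
  assumes p: "bounded_bilinear p" and "C1 f" "C1 g" shows "C1 (\<lambda>x. p (f x) (g x))"
proof -
  from assms obtain f' g' where
    d: "\<And>x. (f has_derivative blinfun_apply (f' x)) (at x)" "continuous_on UNIV f'"
    "\<And>x. (g has_derivative blinfun_apply (g' x)) (at x)" "continuous_on UNIV g'"
    unfolding C1_def by blast
  have "continuous_on UNIV (\<lambda>x. (Blinfun (p (f x)) o\<^sub>L g' x) + (Blinfun (\<lambda>a. p a (g x)) o\<^sub>L f' x))"
    by (intro continuous_intros d C1_continuous assms
        bounded_linear.continuous_on[OF bounded_linear_Blinfun_left[OF p]]
        bounded_linear.continuous_on[OF bounded_linear_Blinfun_left[OF bounded_bilinear.flip[OF p]]])
  then show ?thesis by (rule C1_I[OF has_derivative_bilinear[OF p d(1) d(3)]])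
qed

lemma C2_C1: "C2 f \<Longrightarrow> C1 f"
  unfolding C2_def C1_def[of f] using C1_continuous by blast

lemma C2_bounded_linear:
  assumes "bounded_linear L" shows "C2 L"
  unfolding C2_def
  by (rule exI[of _ "\<lambda>_. Blinfun L"])
     (auto simp: bounded_linear_Blinfun_apply assms bounded_linear_imp_has_derivative C1_const)

lemma C2_compose:
  assumes "C2 f" "C2 g" shows "C2 (\<lambda>x. f (g x))"
proof -
  from assms obtain f' g' where
    d: "\<And>x. (f has_derivative blinfun_apply (f' x)) (at x)" "C1 f'"
    "\<And>x. (g has_derivative blinfun_apply (g' x)) (at x)" "C1 g'"
    unfolding C2_def by blast
  have "((\<lambda>x. f (g x)) has_derivative blinfun_apply (f' (g x) o\<^sub>L g' x)) (at x)" for x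
    using has_derivative_compose[OF d(3) d(1)] by (simp add: blinfun_compose.rep_eq comp_def)
  moreover have "C1 (\<lambda>x. f' (g x) o\<^sub>L g' x)"
    by (intro C1_bilinear[OF bounded_bilinear_blinfun_compose] d C1_compose[OF d(2)] C2_C1 assms)
  ultimately show ?thesis by (rule C2_I)
qed

lemma C2_bilinear:
  assumes p: "bounded_bilinear p" and "C2 f" "C2 g" shows "C2 (\<lambda>x. p (f x) (g x))"
proof -
  from assms obtain f' g' where
    d: "\<And>x. (f has_derivative blinfun_apply (f' x)) (at x)" "C1 f'"
    "\<And>x. (g has_derivative blinfun_apply (g' x)) (at x)" "C1 g'"
    unfolding C2_def by blast
  have "C1 (\<lambda>x. (Blinfun (p (f x)) o\<^sub>L g' x) + (Blinfun (\<lambda>a. p a (g x)) o\<^sub>L f' x))"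
    by (intro C1_add C1_bilinear[OF bounded_bilinear_blinfun_compose] d C2_C1 assms
        C1_compose[OF C1_bounded_linear[OF bounded_linear_Blinfun_left[OF p]]]
        C1_compose[OF C1_bounded_linear[OF bounded_linear_Blinfun_left[OF bounded_bilinear.flip[OF p]]]])
  then show ?thesis by (rule C2_I[OF has_derivative_bilinear[OF p d(1) d(3)]])
qed

text \<open>Passes from vector derivatives to the operator-valued derivatives of \<open>C1\<close>:
  the operator at \<open>t\<close> multiplies \<open>f' t\<close> by a scalar, hence depends
  continuously on \<open>f' t\<close>.\<close>

lemma C1_curve:
  fixes f :: "real \<Rightarrow> 'a::real_normed_vector"
  assumes "\<And>t. (f has_vector_derivative f' t) (at t)" "continuous_on UNIV f'"
  shows "C1 f"
  unfolding C1_def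
  by (rule exI[of _ "\<lambda>t. blinfun_scaleR_left (f' t)"])
     (use assms in \<open>auto simp: has_vector_derivative_def intro!: continuous_intros\<close>)

lemma C2_curve:
  fixes f :: "real \<Rightarrow> 'a::real_normed_vector"
  assumes "\<And>t. (f has_vector_derivative f' t) (at t)" "C1 f'"
  shows "C2 f"
  unfolding C2_def
  by (rule exI[of _ "\<lambda>t. blinfun_scaleR_left (f' t)"])
     (use assms in \<open>auto simp: has_vector_derivative_def
        intro!: C1_compose[OF C1_bounded_linear[OF bounded_linear_blinfun_scaleR_left]]\<close>)

subsection \<open>Rotations and the Cayley map\<close>

text \<open>A linear left inverse of \<open>hat\<close>, defined on all matrices. Being bounded
  linear it commutes with differentiation, whereas \<open>inv hat\<close> is unspecified off the
  range of \<open>hat\<close>.\<close>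

definition axial :: "real^3^3 \<Rightarrow> real^3" where
  "axial A = vector [A $ 3 $ 2, A $ 1 $ 3, A $ 2 $ 1]"

lemma hat_mult: "hat w *v x = cross3 w x"
  unfolding hat_def
  by (rule matrix_works) (unfold_locales, simp_all add: cross3_def vec_eq_iff forall_3 algebra_simps)

lemma hat_explicit:
  "hat w = vector [vector [0, - w $ 3, w $ 2], vector [w $ 3, 0, - w $ 1], vector [- w $ 2, w $ 1, 0]]"
  by (simp add: hat_def matrix_def cross3_def vec_eq_iff forall_3 axis_def)

lemma axial_hat: "axial (hat w) = w"
  by (simp add: axial_def hat_explicit vec_eq_iff forall_3)

lemma vee_hat: "vee (hat w) = w"
  unfolding vee_def by (metis axial_hat injI inv_f_f)

lemma transpose_hat: "transpose (hat w) = - hat w"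
  by (simp add: hat_explicit transpose_def vec_eq_iff forall_3)

lemma bounded_linear_hat: "bounded_linear hat"
  by (intro linear_conv_bounded_linear[THEN iffD1])
     (simp add: hat_explicit vec_eq_iff forall_3 linear_iff)

lemma bounded_linear_axial: "bounded_linear axial"
  by (intro linear_conv_bounded_linear[THEN iffD1])
     (simp add: axial_def vec_eq_iff forall_3 linear_iff)

lemmas hat_simps = linear_add[OF bounded_linear.linear[OF bounded_linear_hat]]
  linear_scale[OF bounded_linear.linear[OF bounded_linear_hat]]
  linear_diff[OF bounded_linear.linear[OF bounded_linear_hat]]

lemma so3_norm_hat: "so3_norm (hat w) = norm w"
  by (simp add: so3_norm_def hat_explicit norm_eq_sqrt_inner inner_vec_def sum_3 trace_def
     transpose_def matrix_matrix_mult_def algebra_simps)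

section \<open>Rotation matrices and conjugation of skew matrices\<close>

lemma SO3_iff: "R \<in> SO3 \<longleftrightarrow> transpose R ** R = mat 1 \<and> R ** transpose R = mat 1 \<and> det R = 1"
  by (simp add: SO3_def rotation_matrix_def orthogonal_matrix_def)

lemma matrix_inv_eqI:
  fixes A B :: "real^'n^'n"
  assumes "A ** B = mat 1" "B ** A = mat 1"
  shows "matrix_inv A = B"
proof -
  have "A ** matrix_inv A = mat 1 \<and> matrix_inv A ** A = mat 1"
    unfolding matrix_inv_def by (rule someI[of _ B]) (use assms in simp)
  then have "B ** (A ** matrix_inv A) = B" by simp
  then show ?thesis using assms by (simp add: matrix_mul_assoc)
qed

lemma matrix_inv_SO3: "R \<in> SO3 \<Longrightarrow> matrix_inv R = transpose R"
  by (simp add: SO3_iff matrix_inv_eqI)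

text \<open>The squared norm is the trace of \<open>transpose R ** R\<close>. This bounds all
  rotations uniformly in the estimates below.\<close>

lemma norm_SO3: "R \<in> SO3 \<Longrightarrow> norm R = sqrt 3"
proof -
  assume "R \<in> SO3"
  then have *: "transpose R ** R = mat 1" by (simp add: SO3_iff)
  have "R \<bullet> R = trace (transpose R ** R)"
    by (simp add: inner_vec_def trace_def sum_3 transpose_def matrix_matrix_mult_def)
  also have "\<dots> = 3" unfolding * by (simp add: trace_def sum_3 mat_def)
  finally show ?thesis by (simp add: norm_eq_sqrt_inner)
qed

lemma SO3_mult: "A \<in> SO3 \<Longrightarrow> B \<in> SO3 \<Longrightarrow> A ** B \<in> SO3"
  by (auto simp: SO3_def rotation_matrix_def orthogonal_matrix_mul det_mul)

lemma bounded_bilinear_matrix_mult: "bounded_bilinear ((**) :: real^3^3 \<Rightarrow> real^3^3 \<Rightarrow> real^3^3)"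
  by (intro bilinear_conv_bounded_bilinear[THEN iffD1])
     (simp add: bilinear_def linear_iff vec_eq_iff forall_3 matrix_matrix_mult_def sum_3
        algebra_simps)

interpretation mmult: bounded_bilinear "(**) :: real^3^3 \<Rightarrow> real^3^3 \<Rightarrow> real^3^3"
  by (rule bounded_bilinear_matrix_mult)

text \<open>This is the adjoint action on so(3). Rotations preserve the cross product, so both sides
  agree on every vector.\<close>

lemma hat_conj:
  assumes "Q \<in> SO3"
  shows "transpose Q ** hat w ** Q = hat (transpose Q *v w)"
proof -
  have r: "rotation_matrix (transpose Q)" using assms
    by (simp add: SO3_def rotation_matrix_def orthogonal_matrix_transpose det_transpose)
  have "(transpose Q ** hat w ** Q) *v x = hat (transpose Q *v w) *v x" for x
  proof -
    have "(transpose Q ** hat w ** Q) *v x = transpose Q *v (cross3 w (Q *v x))"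
      by (simp add: hat_mult flip: matrix_vector_mul_assoc)
    also have "\<dots> = cross3 (transpose Q *v w) (transpose Q *v (Q *v x))"
      using cross_rotation_matrix[OF r] by simp
    finally show ?thesis
      using assms by (simp add: hat_mult matrix_vector_mul_assoc SO3_iff)
  qed
  then show ?thesis by (simp add: matrix_eq)
qed

text \<open>Rodrigues' formula; \<open>rot e \<theta>\<close> is a rotation only for unit vectors \<open>e\<close>.\<close>

definition rot :: "real^3 \<Rightarrow> real \<Rightarrow> real^3^3" where
  "rot e \<theta> = mat 1 + sin \<theta> *\<^sub>R hat e + (1 - cos \<theta>) *\<^sub>R (hat e ** hat e)"

definition drot :: "real^3 \<Rightarrow> real \<Rightarrow> real^3^3" where
  "drot e \<theta> = cos \<theta> *\<^sub>R hat e + sin \<theta> *\<^sub>R (hat e ** hat e)"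

text \<open>The variations only use coordinate axes. In coordinates, the facts about
  \<open>rot\<close> that they require become trigonometric identities between explicit
  entries.\<close>

lemma rot_axis:
  "rot (axis 1 1) \<theta> = vector [vector [1, 0, 0], vector [0, cos \<theta>, - sin \<theta>], vector [0, sin \<theta>, cos \<theta>]]"
  "rot (axis 2 1) \<theta> = vector [vector [cos \<theta>, 0, sin \<theta>], vector [0, 1, 0], vector [- sin \<theta>, 0, cos \<theta>]]"
  "rot (axis 3 1) \<theta> = vector [vector [cos \<theta>, - sin \<theta>, 0], vector [sin \<theta>, cos \<theta>, 0], vector [0, 0, 1]]"
  by (simp_all add: rot_def hat_explicit axis_def vec_eq_iff forall_3 matrix_matrix_mult_def sum_3 mat_def)

lemma drot_axis:
  "drot (axis 1 1) \<theta> = vector [vector [0, 0, 0], vector [0, - sin \<theta>, - cos \<theta>], vector [0, cos \<theta>, - sin \<theta>]]"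
  "drot (axis 2 1) \<theta> = vector [vector [- sin \<theta>, 0, cos \<theta>], vector [0, 0, 0], vector [- cos \<theta>, 0, - sin \<theta>]]"
  "drot (axis 3 1) \<theta> = vector [vector [- sin \<theta>, - cos \<theta>, 0], vector [cos \<theta>, - sin \<theta>, 0], vector [0, 0, 0]]"
  by (simp_all add: drot_def hat_explicit axis_def vec_eq_iff forall_3 matrix_matrix_mult_def sum_3)

lemma hat_axis:
  "hat (axis 1 1) = vector [vector [0, 0, 0], vector [0, 0, - 1], vector [0, 1, 0]]"
  "hat (axis 2 1) = vector [vector [0, 0, 1], vector [0, 0, 0], vector [- 1, 0, 0]]"
  "hat (axis 3 1) = vector [vector [0, - 1, 0], vector [1, 0, 0], vector [0, 0, 0]]"
  by (simp_all add: hat_explicit axis_def)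

lemma rot_SO3: "rot (axis i 1) \<theta> \<in> SO3"
proof -
  consider "i = 1" | "i = 2" | "i = 3" using exhaust_3 by blast
  then show ?thesis
    by cases (simp_all add: SO3_iff rot_axis det_3 transpose_def vec_eq_iff
      forall_3 matrix_matrix_mult_def sum_3 mat_def flip: power2_eq_square)
qed

text \<open>Rotations about a fixed unit axis form the one-parameter group generated by
  \<open>hat e\<close>, so the left-trivialized derivative is constant.\<close>

lemma rot_drot: "transpose (rot (axis i 1) \<theta>) ** drot (axis i 1) \<theta> = hat (axis i 1)"
proof -
  consider "i = 1" | "i = 2" | "i = 3" using exhaust_3 by blast
  then show ?thesis
    by cases (simp_all add: rot_axis drot_axis hat_axis transpose_def vec_eq_iff
      forall_3 matrix_matrix_mult_def sum_3 sin_squared_eq flip: power2_eq_square)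
qed

lemma rot_deriv: "(rot e has_vector_derivative drot e \<theta>) (at \<theta>)"
  unfolding rot_def[abs_def] drot_def
  by (auto intro!: derivative_eq_intros)

text \<open>Transposing negates \<open>hat e\<close> and fixes its square, so only the sine term
  changes sign.\<close>

lemma transpose_rot_mult:
  "transpose (rot e \<theta>) *v x = x - sin \<theta> *\<^sub>R cross3 e x + (1 - cos \<theta>) *\<^sub>R cross3 e (cross3 e x)"
  by (simp add: rot_def hat_explicit transpose_def vec_eq_iff cross3_def
      forall_3 matrix_matrix_mult_def matrix_vector_mult_def sum_3 mat_def algebra_simps)

lemma hat_so3: "hat w \<in> so3"
  by (simp add: so3_def transpose_hat)

text \<open>With \<open>M\<close> and \<open>P\<close> the two Cayley factors, transposition swaps
  them and they commute, which makes the quotient orthogonal. The second claim is an exact expansion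
  whose remainder contains a rotation, hence a bounded factor.\<close>

lemma
  shows cay_SO3: "cay (hat w) \<in> SO3"
    and cay_expand: "cay (hat w) = mat 1 + hat w + (1/4) *\<^sub>R (hat w ** hat w ** (mat 1 + cay (hat w)))"
proof -
  define A where "A = hat w"
  define M where "M = mat 1 - (1/2) *\<^sub>R A"
  define P where "P = mat 1 + (1/2) *\<^sub>R A"
  define C where "C = cay A"
  have tM: "transpose M = P" and tP: "transpose P = M"
    by (simp_all add: M_def P_def A_def hat_explicit transpose_def vec_eq_iff forall_3 mat_def)
  \<comment> \<open>Positive for every \<open>w\<close>, so the inverse in the Cayley map exists
    without any smallness condition.\<close>
  have "det M = 1 + (1/4) * (w \<bullet> w)"
    by (simp add: M_def A_def hat_explicit det_3 mat_def inner_vec_def sum_3 field_simps)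
  then have detM: "det M > 0" using inner_ge_zero[of w] by linarith
  then obtain B where B: "M ** B = mat 1" "B ** M = mat 1"
    using invertible_det_nz[of M] by (auto simp: invertible_def)
  then have C: "C = B ** P" by (simp add: C_def cay_def matrix_inv_eqI flip: M_def P_def)
  have MP: "M ** P = P ** M"
    by (simp add: M_def P_def mmult.add_left mmult.add_right mmult.diff_left mmult.diff_right)
  have "B ** (M ** P) ** B = B ** (P ** M) ** B" by (simp add: MP)
  then have BP: "P ** B = B ** P" using B
    by (metis matrix_mul_assoc matrix_mul_lid matrix_mul_rid)
  have tB: "transpose B ** P = mat 1" "P ** transpose B = mat 1"
    using arg_cong[OF B(1), of transpose] arg_cong[OF B(2), of transpose]
    by (simp_all add: matrix_transpose_mul tM)
  \<comment> \<open>The left factor is read as \<open>P ** B\<close> and the right one as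
    \<open>B ** P\<close>; then \<open>M\<close>, the transpose of \<open>P\<close>, meets its
    inverse \<open>B\<close>.\<close>
  have "transpose C ** C = transpose B ** (M ** B) ** P"
    by (subst (1) C, subst BP[symmetric]) (simp add: C matrix_transpose_mul tP matrix_mul_assoc)
  then have "transpose C ** C = mat 1" by (simp add: B tB)
  then have orth: "orthogonal_matrix C" by (simp add: orthogonal_matrix)
  \<comment> \<open>\<open>P\<close> is the transpose of \<open>M\<close>, so the two determinants
    agree and their quotient is 1.\<close>
  have "det M * det C = det M"
    using arg_cong[OF C, of det] arg_cong[OF B(1), of det] det_transpose[of M] by (simp add: det_mul tM mult.assoc[symmetric])
  then have "det C = 1" using detM by simp
  with orth show "cay (hat w) \<in> SO3" by (simp add: SO3_def rotation_matrix_def C_def A_def)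
  have "M ** C = P" using B by (simp add: C matrix_mul_assoc)
  \<comment> \<open>The defining equation solved for \<open>C\<close>. Inserting it into its own
    last term pushes the remainder to second order.\<close>
  then have 1: "C = mat 1 + (1/2) *\<^sub>R A + (1/2) *\<^sub>R (A ** C)"
    by (simp add: M_def P_def mmult.diff_left mmult.scaleR_left algebra_simps)
  have "A ** C = A + (1/2) *\<^sub>R (A ** A) + (1/2) *\<^sub>R (A ** A ** C)"
    by (subst 1) (simp add: mmult.add_right mmult.scaleR_right matrix_mul_assoc)
  with 1 have "C = mat 1 + ((1/2) *\<^sub>R A + (1/2) *\<^sub>R A) + (1/4) *\<^sub>R (A ** A ** (mat 1 + C))"
    by (simp add: mmult.add_right scaleR_add_right add.assoc)
  also have "(1/2) *\<^sub>R A + (1/2) *\<^sub>R A = A" by (simp flip: scaleR_add_left)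
  finally have "C = mat 1 + A + (1/4) *\<^sub>R (A ** A ** (mat 1 + C))" .
  then show "cay (hat w) = mat 1 + hat w + (1/4) *\<^sub>R (hat w ** hat w ** (mat 1 + cay (hat w)))"
    by (simp add: C_def A_def)
qed

text \<open>Moves estimates from the group to the linear space of matrices:
  \<open>mat 1 - A ** transpose B\<close> equals \<open>(B - A) ** transpose B\<close>, and the
  second factor has norm \<open>sqrt 3\<close>.\<close>

lemma SO3_dist_le_norm:
  obtains K where "K \<ge> 0" "\<And>A B. B \<in> SO3 \<Longrightarrow> SO3_dist A B \<le> K * norm (A - B)"
proof -
  obtain K where K: "K \<ge> 0" "\<And>(a::real^3^3) (b::real^3^3). norm (a ** b) \<le> norm a * norm b * K"
    using mmult.nonneg_bounded by blast
  have "SO3_dist A B \<le> (sqrt 3 * K) * norm (A - B)" if "B \<in> SO3" for A B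
  proof -
    have "transpose B \<in> SO3" using that by (auto simp: SO3_iff)
    have "mat 1 - A ** transpose B = (B - A) ** transpose B"
      using that by (simp add: mmult.diff_left SO3_iff)
    then have "SO3_dist A B \<le> norm (B - A) * norm (transpose B) * K"
      using K(2)[of "B - A" "transpose B"] by (simp add: SO3_dist_def)
    then show ?thesis using norm_SO3[OF \<open>transpose B \<in> SO3\<close>] by (simp add: norm_minus_commute ac_simps)
  qed
  then show ?thesis using that[of "sqrt 3 * K"] K by auto
qed

text \<open>The remainder in \<open>cay_expand\<close> has two factors \<open>hat w\<close> and a
  factor of norm at most \<open>2 * sqrt 3\<close>.\<close>

lemma cay_error:
  obtains K where "K \<ge> 0" "\<And>w. norm (cay (hat w) - mat 1 - hat w) \<le> K * (norm w)\<^sup>2"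
proof -
  obtain K where K: "K \<ge> 0" "\<And>(a::real^3^3) (b::real^3^3). norm (a ** b) \<le> norm a * norm b * K"
    using mmult.nonneg_bounded by blast
  obtain H where H: "H \<ge> 0" "\<And>w. norm (hat w) \<le> norm w * H"
    using bounded_linear.nonneg_bounded[OF bounded_linear_hat] by blast
  let ?B = "(1/4) * ((H * H * K) * (2 * sqrt 3) * K)"
  have "norm (cay (hat w) - mat 1 - hat w) \<le> ?B * (norm w)\<^sup>2" for w
  proof -
    have "mat 1 \<in> SO3" by (simp add: SO3_iff)
    then have "norm (mat 1 + cay (hat w)) \<le> 2 * sqrt 3"
      using norm_triangle_ineq[of "mat 1" "cay (hat w)"] norm_SO3 cay_SO3[of w] by (smt (verit))
    moreover have "norm (hat w ** hat w) \<le> (norm w * H) * (norm w * H) * K"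
      by (rule order_trans[OF K(2)]) (intro mult_right_mono mult_mono H K; simp add: H)
    ultimately have "norm (hat w ** hat w ** (mat 1 + cay (hat w)))
        \<le> ((norm w * H) * (norm w * H) * K) * (2 * sqrt 3) * K"
      by (intro order_trans[OF K(2)] mult_right_mono mult_mono K) (auto simp: H K)
    moreover have "cay (hat w) - mat 1 - hat w = (1/4) *\<^sub>R (hat w ** hat w ** (mat 1 + cay (hat w)))"
      by (subst (1) cay_expand) simp
    ultimately show ?thesis by (simp add: power2_eq_square ac_simps)
  qed
  then show ?thesis using that[of ?B] H K by auto
qed

subsection \<open>Reduction of the unreduced system\<close>

text \<open>A form of the fundamental lemma of the calculus of variations; parabolas suffice as test
  functions because the interval is arbitrary. If \<open>G t > 0\<close>, then on a short interval
  centred at \<open>t\<close> the integrand is nonnegative and has integral zero, so it vanishes;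
  but it is positive at the midpoint \<open>t\<close>.\<close>

lemma integral_parabola_eq_0_imp_nonpos:
  fixes G :: "real \<Rightarrow> real"
  assumes G: "continuous_on UNIV G"
    and z: "\<And>a b. a < b \<Longrightarrow> integral {a..b} (\<lambda>t. (t - a) * (b - t) * G t) = 0"
  shows "G t \<le> 0"
proof (rule ccontr)
  assume "\<not> G t \<le> 0"
  then have "G t > 0" by simp
  moreover have "isCont G t" using G by (simp add: continuous_on_eq_continuous_at)
  ultimately obtain d where d: "d > 0" "\<And>x. \<bar>x - t\<bar> < d \<Longrightarrow> \<bar>G x - G t\<bar> < G t"
    unfolding continuous_at_eps_delta dist_real_def by meson
  define a b where "a = t - d/2" and "b = t + d/2"
  have ab: "a < b" using d by (simp add: a_def b_def)
  have Gpos: "G x > 0" if "x \<in> {a..b}" for x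
  proof -
    have "\<bar>x - t\<bar> < d" using that d(1) unfolding a_def b_def atLeastAtMost_iff by linarith
    from d(2)[OF this] show ?thesis by linarith
  qed
  have c: "continuous_on {a..b} (\<lambda>t. (t - a) * (b - t) * G t)"
    by (intro continuous_intros continuous_on_subset[OF G]) auto
  have "(x - a) * (b - x) * G x \<ge> 0" if "x \<in> {a..b}" for x
    using Gpos[OF that] that by simp
  then have "\<forall>x\<in>{a..b}. (x - a) * (b - x) * G x = 0"
    using integral_eq_0_iff[OF c ab] z[OF ab] by blast
  moreover have "t \<in> {a..b}" using d(1) by (simp add: a_def b_def)
  ultimately have "(t - a) * (b - t) * G t = 0" by blast
  then show False using \<open>G t > 0\<close> d(1) by (simp add: a_def b_def)
qed

lemma continuous_eq_0I:
  fixes G :: "real \<Rightarrow> real"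
  assumes G: "continuous_on UNIV G"
    and z: "\<And>a b. a < b \<Longrightarrow> integral {a..b} (\<lambda>t. (t - a) * (b - t) * G t) = 0"
  shows "G t = 0"
  using integral_parabola_eq_0_imp_nonpos[OF G z, of t]
    integral_parabola_eq_0_imp_nonpos[of "\<lambda>t. - G t" t] continuous_on_minus[OF G] z
  by force

section \<open>Variations by rotation about a body axis\<close>

lemma bounded_linear_transpose: "bounded_linear (transpose :: real^3^3 \<Rightarrow> real^3^3)"
  by (intro linear_conv_bounded_linear[THEN iffD1])
     (simp add: transpose_def vec_eq_iff forall_3 linear_iff)

lemma drot_deriv: "(drot e has_vector_derivative (- sin \<theta> *\<^sub>R hat e + cos \<theta> *\<^sub>R (hat e ** hat e))) (at \<theta>)"
  unfolding drot_def[abs_def] by (auto intro!: derivative_eq_intros)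

lemma C2_rot: "C2 (rot e)"
  by (rule C2_curve[OF rot_deriv C1_curve[OF drot_deriv]]) (intro continuous_intros)

lemma C2_parabola: "C2 (\<lambda>t::real. (t - a) * (b - t))"
proof (rule C2_curve[OF _ C1_curve])
  show "((\<lambda>t. (t - a) * (b - t)) has_vector_derivative (a + b - 2 * t)) (at t)" for t
    by (auto simp flip: has_real_derivative_iff_has_vector_derivative intro!: derivative_eq_intros)
  show "((\<lambda>t. a + b - 2 * t) has_vector_derivative - 2) (at t)" for t :: real
    by (auto simp flip: has_real_derivative_iff_has_vector_derivative intro!: derivative_eq_intros)
qed (intro continuous_intros)

text \<open>The angle vanishes for \<open>u = 0\<close> and at both endpoints, where the rotation is
  the identity. Joint regularity in \<open>(u, t)\<close> is inherited from \<open>X\<close> and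
  \<open>rot\<close>.\<close>

lemma fixed_endpoint_variation_rot:
  assumes "C2 X" "\<And>t. X t \<in> SO3"
  shows "fixed_endpoint_variation X a b (\<lambda>u t. X t ** rot (axis i 1) (u * ((t - a) * (b - t))))"
proof -
  have "C2 (\<lambda>z. X (snd z) ** rot (axis i 1) (fst z * ((snd z - a) * (b - snd z))))"
    by (intro C2_bilinear[OF bounded_bilinear_matrix_mult] C2_bilinear[OF bounded_bilinear_mult]
        C2_compose[OF assms(1)] C2_compose[OF C2_rot] C2_compose[OF C2_parabola]
        C2_bounded_linear bounded_linear_fst bounded_linear_snd)
  moreover have "rot (axis i 1) 0 = mat 1" by (simp add: rot_def)
  ultimately show ?thesis
    by (simp add: fixed_endpoint_variation_def case_prod_unfold SO3_mult assms(2) rot_SO3)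
qed

text \<open>With \<open>Q\<close> the rotation, the body velocity of the product is
  \<open>transpose Q *v w\<close> plus \<open>\<theta>'\<close> times the axis, by
  \<open>hat_conj\<close> and \<open>rot_drot\<close>; \<open>x\<close> is this vector written out.
  By left invariance the Lagrangian sees nothing else.\<close>

lemma lagrangian_rot_variation:
  fixes w :: "real^3" and i :: 3
  assumes X: "X t \<in> SO3" "(X has_vector_derivative X t ** hat w) (at t)"
    and \<theta>: "(\<theta> has_real_derivative \<theta>') (at t)"
  defines "\<Gamma> \<equiv> \<lambda>t. X t ** rot (axis i 1) (\<theta> t)"
    and "x \<equiv> w - sin (\<theta> t) *\<^sub>R cross3 (axis i 1) w
        + (1 - cos (\<theta> t)) *\<^sub>R cross3 (axis i 1) (cross3 (axis i 1) w) + \<theta>' *\<^sub>R axis i 1"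
  shows "lagrangian J (\<Gamma> t) (vector_derivative \<Gamma> (at t)) = 1/2 * ((J *v x) \<bullet> x)"
proof -
  let ?e = "axis i 1 :: real^3"
  let ?Q = "rot ?e (\<theta> t)"
  have Q: "?Q \<in> SO3" by (rule rot_SO3)
  have "((\<lambda>t. rot ?e (\<theta> t)) has_vector_derivative \<theta>' *\<^sub>R drot ?e (\<theta> t)) (at t)"
    using vector_diff_chain_at[of \<theta> \<theta>' t "rot ?e"] \<theta> rot_deriv
    by (simp add: has_real_derivative_iff_has_vector_derivative comp_def)
  then have "(\<Gamma> has_vector_derivative X t ** (\<theta>' *\<^sub>R drot ?e (\<theta> t)) + (X t ** hat w) ** ?Q) (at t)"
    unfolding \<Gamma>_def by (intro mmult.has_vector_derivative X)
  then have d: "vector_derivative \<Gamma> (at t) = X t ** (\<theta>' *\<^sub>R drot ?e (\<theta> t)) + (X t ** hat w) ** ?Q"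
    by (rule vector_derivative_at)
  have "transpose (\<Gamma> t) ** vector_derivative \<Gamma> (at t)
      = transpose ?Q ** (transpose (X t) ** X t) ** (\<theta>' *\<^sub>R drot ?e (\<theta> t))
        + transpose ?Q ** (transpose (X t) ** X t) ** hat w ** ?Q"
    unfolding d unfolding \<Gamma>_def by (simp only: matrix_transpose_mul mmult.add_right matrix_mul_assoc)
  also have "\<dots> = hat (transpose ?Q *v w) + \<theta>' *\<^sub>R hat ?e"
    using X(1) by (simp add: SO3_iff hat_conj[OF Q] mmult.scaleR_right rot_drot del: transpose_matrix_vector)
  also have "\<dots> = hat x"
    unfolding x_def transpose_rot_mult by (simp add: hat_simps)
  finally show ?thesis
    using SO3_mult[OF X(1) Q]
    by (simp add: lagrangian_def reduced_lagrangian_def matrix_inv_SO3 \<Gamma>_def vee_hat)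
qed

section \<open>Reduction to the Suslov equations\<close>

lemma inertia_symmetric: "inertia_tensor J \<Longrightarrow> (J *v x) \<bullet> y = (J *v y) \<bullet> x"
  unfolding inertia_tensor_def by (metis dot_lmul_matrix inner_commute transpose_matrix_vector)

text \<open>Body angular velocity, written with \<open>transpose\<close> and \<open>axial\<close> in
  place of \<open>matrix_inv\<close> and \<open>vee\<close> so that the product rule applies
  directly.\<close>

definition angular_velocity :: "(real \<Rightarrow> real^3^3) \<Rightarrow> (real \<Rightarrow> real^3^3) \<Rightarrow> real \<Rightarrow> real^3" where
  "angular_velocity X V t = axial (transpose (X t) ** V t)"

lemma angular_velocity_eqI: "X t \<in> SO3 \<Longrightarrow> V t = X t ** hat w \<Longrightarrow> angular_velocity X V t = w"
  by (simp add: angular_velocity_def matrix_mul_assoc SO3_iff axial_hat)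

lemma unreduced_velocity:
  assumes "unreduced_solution J X V \<Lambda>"
  shows "X t \<in> SO3" "(X has_vector_derivative V t) (at t)"
    "V t = X t ** hat (angular_velocity X V t)" "angular_velocity X V t $ 3 = 0"
proof -
  have X: "X t \<in> SO3" "(X has_vector_derivative V t) (at t)" "V t \<in> constraint_distribution (X t)"
    using assms[unfolded unreduced_solution_def, THEN conjunct1] by auto
  then obtain w where w: "V t = X t ** hat w" "w $ 3 = 0"
    by (auto simp: constraint_distribution_def)
  then have "angular_velocity X V t = w" using X by (intro angular_velocity_eqI)
  with w X show "X t \<in> SO3" "(X has_vector_derivative V t) (at t)"
    "V t = X t ** hat (angular_velocity X V t)" "angular_velocity X V t $ 3 = 0" by simp_all
qed

text \<open>For each axis and each interval the principle yields a weighted integral of one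
  component of the Suslov equation; intervals being arbitrary, the component vanishes pointwise.
  Differentiability of the angular velocity is derived from the \<open>C1\<close> regularity of
  \<open>V\<close>.\<close>

lemma unreduced_imp_suslov:
  assumes J: "inertia_tensor J" and sol: "unreduced_solution J X V \<Lambda>"
  shows "suslov_solution J (angular_velocity X V) \<Lambda>"
proof -
  define W where "W = angular_velocity X V"
  note X = unreduced_velocity(1)[OF sol] and dXV = unreduced_velocity(2)[OF sol]
  have W: "V t = X t ** hat (W t)" "W t $ 3 = 0" for t
    using unreduced_velocity(3,4)[OF sol] by (simp_all add: W_def)
  have dX: "(X has_vector_derivative X t ** hat (W t)) (at t)" for t
    using dXV W(1) by simp
  \<comment> \<open>The continuous acceleration makes \<open>X\<close> of class \<open>C2\<close>,
    so that its variations are admissible, and makes \<open>W'\<close> continuous.\<close>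
  obtain D where dV: "\<And>t. (V has_vector_derivative D t) (at t)" and D: "continuous_on UNIV D"
    using sol[unfolded unreduced_solution_def, THEN conjunct2, THEN conjunct1]
    unfolding C1_differentiable_on_def by auto
  have cX: "continuous_on UNIV X" and cV: "continuous_on UNIV V"
    using dXV dV by (meson continuous_at_imp_continuous_on has_vector_derivative_continuous)+
  have c\<Lambda>: "continuous_on UNIV \<Lambda>" using sol[unfolded unreduced_solution_def] by (elim conjE)
  have C2X: "C2 X" by (rule C2_curve[OF dXV C1_curve[OF dV D]])
  define W' where "W' t = axial (transpose (X t) ** D t + transpose (V t) ** V t)" for t
  have dW: "(W has_vector_derivative W' t) (at t)" for t
    unfolding W_def W'_def angular_velocity_def[abs_def]
    by (intro bounded_linear.has_vector_derivative[OF bounded_linear_axial] mmult.has_vector_derivative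
        bounded_linear.has_vector_derivative[OF bounded_linear_transpose] dXV dV)
  have cW': "continuous_on UNIV W'"
    unfolding W'_def
    by (intro bounded_linear.continuous_on[OF bounded_linear_axial] continuous_intros
        mmult.continuous_on bounded_linear.continuous_on[OF bounded_linear_transpose] cX cV D)
  have cW: "continuous_on UNIV W"
    using dW by (meson continuous_at_imp_continuous_on has_vector_derivative_continuous)
  note clin = bounded_linear.continuous_on[OF matrix_vector_mul_bounded_linear]
  have eq: "(J *v W' t - cross3 (J *v W t) (W t) - \<Lambda> t *\<^sub>R e3) $ i = 0" for t i
  proof -
    define e :: "real^3" where "e = axis i 1"
    \<comment> \<open>Up to the identity \<open>(J *v W t) \<bullet> (hat e *v W t) = - (cross3 (J
      *v W t) (W t) \<bullet> e)\<close>, shown at the end, this is component \<open>i\<close> of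
      the Suslov equation.\<close>
    define G where "G t = (J *v W' t) \<bullet> e + (J *v W t) \<bullet> (hat e *v W t) - \<Lambda> t * (e3 \<bullet> e)" for t
    have cG: "continuous_on UNIV G"
      unfolding G_def by (intro continuous_intros clin cW cW' c\<Lambda>)
    have "G t = 0"
    proof (rule continuous_eq_0I[OF cG])
      fix a b :: real assume ab: "a < b"
      define \<phi> where "\<phi> t = (t - a) * (b - t)" for t
      define \<phi>' where "\<phi>' t = a + b - 2 * t" for t
      have d\<phi>: "(\<phi> has_real_derivative \<phi>' t) (at t)" for t
        unfolding \<phi>_def \<phi>'_def by (auto intro!: derivative_eq_intros)
      have c\<phi>: "continuous_on S \<phi>" "continuous_on S \<phi>'" for S
        unfolding \<phi>_def \<phi>'_def by (intro continuous_intros)+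
      define \<Gamma> where "\<Gamma> u t = X t ** rot e (u * \<phi> t)" for u t
      \<comment> \<open>The body velocity of the varied curve, with \<open>hat e *v\<close> instead
        of \<open>cross3\<close> so that rules for linear maps apply; \<open>dx\<close> is its
        derivative in \<open>u\<close>.\<close>
      define x where "x u t = W t - sin (u * \<phi> t) *\<^sub>R (hat e *v W t)
        + (1 - cos (u * \<phi> t)) *\<^sub>R (hat e *v (hat e *v W t)) + (u * \<phi>' t) *\<^sub>R e" for u t
      define dx where "dx u t = \<phi> t *\<^sub>R (sin (u * \<phi> t) *\<^sub>R (hat e *v (hat e *v W t))
        - cos (u * \<phi> t) *\<^sub>R (hat e *v W t)) + \<phi>' t *\<^sub>R e" for u t
      have var: "fixed_endpoint_variation X a b \<Gamma>"
        unfolding \<Gamma>_def \<phi>_def e_def by (rule fixed_endpoint_variation_rot[OF C2X X])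
      have act: "action J a b (\<Gamma> u) = integral (cbox a b) (\<lambda>t. 1/2 * ((J *v x u t) \<bullet> x u t))" for u
        unfolding action_def \<Gamma>_def x_def e_def hat_mult interval_cbox
        by (intro integral_cong lagrangian_rot_variation X dX DERIV_cmult d\<phi>)
      have dx: "((\<lambda>u. x u t) has_vector_derivative dx u t) (at u)" for u t
        unfolding x_def dx_def by (auto intro!: derivative_eq_intros simp: algebra_simps)
      have dl: "((\<lambda>u. 1/2 * ((J *v x u t) \<bullet> x u t)) has_real_derivative (J *v x u t) \<bullet> dx u t) (at u within S)" for u t S
      proof -
        have "((\<lambda>u. (J *v x u t) \<bullet> x u t) has_vector_derivative
            ((J *v x u t) \<bullet> dx u t + (J *v dx u t) \<bullet> x u t)) (at u)"
          by (intro bounded_bilinear.has_vector_derivative[OF bounded_bilinear_inner] dx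
            bounded_linear.has_vector_derivative[OF matrix_vector_mul_bounded_linear])
        \<comment> \<open>Symmetry of \<open>J\<close> merges the two terms of the product rule; the
          resulting 2 cancels the 1/2 of the kinetic energy.\<close>
        then have "((\<lambda>u. (J *v x u t) \<bullet> x u t) has_real_derivative
            (2 * ((J *v x u t) \<bullet> dx u t))) (at u)"
          by (simp add: inertia_symmetric[OF J, of "dx u t"] has_real_derivative_iff_has_vector_derivative)
        from DERIV_cmult[OF this, of "1/2"] show ?thesis
          by (simp add: has_field_derivative_at_within)
      qed
      have cW2: "continuous_on S (\<lambda>z::real\<times>real. W (snd z))"
        and c\<phi>2: "continuous_on S (\<lambda>z::real\<times>real. \<phi> (snd z))" "continuous_on S (\<lambda>z::real\<times>real. \<phi>' (snd z))" for S
        by (intro continuous_on_compose2[OF cW] continuous_on_compose2[OF c\<phi>(1)[of UNIV]]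
            continuous_on_compose2[OF c\<phi>(2)[of UNIV]] continuous_intros; simp)+
      have cx: "continuous_on S (\<lambda>z. x (fst z) (snd z))" "continuous_on S (\<lambda>z. dx (fst z) (snd z))" for S
        unfolding x_def dx_def by (intro continuous_intros clin cW2 c\<phi>2)+
      have cxu: "continuous_on S (x u)" for S u
        using continuous_on_compose2[OF cx(1)[of UNIV], of S "\<lambda>t. (u, t)"]
        by (simp add: continuous_intros)
      \<comment> \<open>Differentiation under the integral sign, justified by joint continuity of
        \<open>x\<close> and \<open>dx\<close>.\<close>
      have "((\<lambda>u. action J a b (\<Gamma> u)) has_real_derivative
          integral (cbox a b) (\<lambda>t. (J *v x 0 t) \<bullet> dx 0 t)) (at 0)"
        unfolding act
        by (rule leibniz_rule_field_derivative[where U = UNIV, OF dl])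
           (auto simp: case_prod_unfold intro!: continuous_intros clin cx cxu integrable_continuous_interval)
      moreover have "((\<lambda>u. action J a b (\<Gamma> u)) has_real_derivative
           - integral {a..b} (\<lambda>t. \<Lambda> t *
                annihilator_form (X t) (vector_derivative (\<lambda>u. \<Gamma> u t) (at 0)))) (at 0)"
        using sol[unfolded unreduced_solution_def, THEN conjunct2, THEN conjunct2, THEN conjunct2,
            rule_format, OF ab var] .
      ultimately have "integral {a..b} (\<lambda>t. (J *v x 0 t) \<bullet> dx 0 t) =
           - integral {a..b} (\<lambda>t. \<Lambda> t *
                annihilator_form (X t) (vector_derivative (\<lambda>u. \<Gamma> u t) (at 0)))"
        by (auto dest: DERIV_unique)
      \<comment> \<open>At \<open>u = 0\<close> the variation field, translated back to the
        identity, is \<open>\<phi> t\<close> times \<open>hat e\<close>.\<close>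
      moreover have "annihilator_form (X t) (vector_derivative (\<lambda>u. \<Gamma> u t) (at 0)) = \<phi> t * (e3 \<bullet> e)" for t
      proof -
        have "((\<lambda>u. rot e (u * \<phi> t)) has_vector_derivative \<phi> t *\<^sub>R drot e (0 * \<phi> t)) (at 0)"
          using vector_diff_chain_at[of "\<lambda>u. u * \<phi> t" "\<phi> t" 0 "rot e"] rot_deriv
            DERIV_cmult_right[OF DERIV_ident, of "\<phi> t"]
          by (simp add: has_real_derivative_iff_has_vector_derivative comp_def)
        from bounded_linear.has_vector_derivative[OF mmult.bounded_linear_right this, of "X t"]
        have "((\<lambda>u. \<Gamma> u t) has_vector_derivative X t ** (\<phi> t *\<^sub>R hat e)) (at 0)"
          by (simp add: \<Gamma>_def drot_def)
        then have "vector_derivative (\<lambda>u. \<Gamma> u t) (at 0) = X t ** (\<phi> t *\<^sub>R hat e)"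
          by (rule vector_derivative_at)
        then have "matrix_inv (X t) ** vector_derivative (\<lambda>u. \<Gamma> u t) (at 0) = hat (\<phi> t *\<^sub>R e)"
          using X[of t] by (simp add: matrix_inv_SO3 matrix_mul_assoc SO3_iff hat_simps)
        then show ?thesis by (simp add: annihilator_form_def vee_hat)
      qed
      ultimately have 1: "integral {a..b} (\<lambda>t. (J *v x 0 t) \<bullet> dx 0 t) =
           - integral {a..b} (\<lambda>t. \<Lambda> t * (\<phi> t * (e3 \<bullet> e)))" by simp
      \<comment> \<open>Integration by parts; the boundary terms vanish since \<open>\<phi>\<close>
        is zero at \<open>a\<close> and \<open>b\<close>.\<close>
      have "((\<lambda>t. \<phi> t *\<^sub>R ((J *v W t) \<bullet> e)) has_vector_derivative
          (\<phi> t *\<^sub>R ((J *v W' t) \<bullet> e) + \<phi>' t *\<^sub>R ((J *v W t) \<bullet> e))) (at t)" for t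
        using d\<phi> by (intro bounded_bilinear.has_vector_derivative[OF bounded_bilinear_scaleR]
            bounded_linear.has_vector_derivative[OF bounded_linear_inner_left]
            bounded_linear.has_vector_derivative[OF matrix_vector_mul_bounded_linear] dW)
          (simp add: has_real_derivative_iff_has_vector_derivative)
      then have "((\<lambda>t. \<phi> t *\<^sub>R ((J *v W' t) \<bullet> e) + \<phi>' t *\<^sub>R ((J *v W t) \<bullet> e)) has_integral
          (\<phi> b *\<^sub>R ((J *v W b) \<bullet> e) - \<phi> a *\<^sub>R ((J *v W a) \<bullet> e))) {a..b}"
        using ab by (intro fundamental_theorem_of_calculus) (auto intro: has_vector_derivative_at_within)
      then have 2: "integral {a..b} (\<lambda>t. \<phi> t * ((J *v W' t) \<bullet> e) + \<phi>' t * ((J *v W t) \<bullet> e)) = 0"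
        by (simp add: \<phi>_def integral_unique)
      note cs = continuous_intros clin continuous_on_subset[OF cW] continuous_on_subset[OF cW']
        continuous_on_subset[OF c\<Lambda>] c\<phi> integrable_continuous_interval
      \<comment> \<open>At \<open>u = 0\<close>, \<open>dx\<close> is \<open>\<phi>'\<close> times
        \<open>e\<close> minus \<open>\<phi>\<close> times \<open>hat e *v W t\<close>. The
        \<open>\<phi>'\<close> terms cancel and a multiple of \<open>\<phi>\<close> remains.\<close>
      have "integral {a..b} (\<lambda>t. \<phi> t * G t) =
          integral {a..b} (\<lambda>t. \<phi> t * ((J *v W' t) \<bullet> e) + \<phi>' t * ((J *v W t) \<bullet> e))
          - (integral {a..b} (\<lambda>t. (J *v x 0 t) \<bullet> dx 0 t)
             + integral {a..b} (\<lambda>t. \<Lambda> t * (\<phi> t * (e3 \<bullet> e))))"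
        unfolding x_def dx_def G_def
        by (subst integral_add[symmetric], (intro cs; simp)+, subst integral_diff[symmetric], (intro cs; simp)+)
           (rule integral_cong, simp add: algebra_simps inner_add_right inner_diff_right)
      also have "\<dots> = 0" using 1 2 by simp
      finally show "integral {a..b} (\<lambda>t. (t - a) * (b - t) * G t) = 0" by (simp add: \<phi>_def)
    qed
    moreover have "(J *v W t) \<bullet> (hat e *v W t) = - (cross3 (J *v W t) (W t) \<bullet> e)"
      by (simp add: hat_mult) (metis cross_triple cross_skew inner_minus_left inner_commute)
    ultimately show ?thesis by (simp add: G_def e_def inner_axis)
  qed
  show ?thesis
    unfolding suslov_solution_def W_def[symmetric]
  proof (intro allI conjI exI)
    fix t
    show "J *v W' t = cross3 (J *v W t) (W t) + \<Lambda> t *\<^sub>R e3"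
      using eq[of t] by (simp add: vec_eq_iff algebra_simps)
  qed (use W dW in auto)
qed

subsection \<open>Error estimates\<close>

text \<open>Minimize the quadratic form on the compact unit sphere and rescale. This turns energy
  bounds into norm bounds.\<close>

lemma inertia_coercive:
  assumes J: "inertia_tensor J"
  obtains c where "c > 0" "\<And>x. c * (norm x)\<^sup>2 \<le> (J *v x) \<bullet> x"
proof -
  have c: "continuous_on (sphere 0 1) (\<lambda>x::real^3. (J *v x) \<bullet> x)"
    by (intro continuous_intros bounded_linear.continuous_on[OF matrix_vector_mul_bounded_linear])
  have ne: "sphere (0::real^3) 1 \<noteq> {}" by simp
  obtain m :: "real^3" where m: "norm m = 1" "\<And>y. norm y = 1 \<Longrightarrow> (J *v m) \<bullet> m \<le> (J *v y) \<bullet> y"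
    using continuous_attains_inf[OF compact_sphere ne c] by auto
  have "(J *v m) \<bullet> m * (norm x)\<^sup>2 \<le> (J *v x) \<bullet> x" for x
  proof (cases "x = 0")
    case False
    define y where "y = (1 / norm x) *\<^sub>R x"
    have y: "norm y = 1" "x = norm x *\<^sub>R y" using False by (auto simp: y_def)
    have "(J *v x) \<bullet> x = (norm x)\<^sup>2 * ((J *v y) \<bullet> y)"
      by (subst (1 2) y(2)) (simp add: matrix_vector_mult_scaleR power2_eq_square)
    then show ?thesis
      using mult_right_mono[OF m(2)[OF y(1)] zero_le_power2[of "norm x"]] by (simp add: mult.commute)
  qed simp
  moreover have "(J *v m) \<bullet> m > 0"
    using J m(1) unfolding inertia_tensor_def by (metis norm_zero zero_neq_one)
  ultimately show ?thesis using that by blast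
qed

text \<open>Differentiating the constraint puts \<open>W'\<close> in the constraint plane too, so
  the multiplier drops out when the equation is paired with \<open>W'\<close>.\<close>

lemma suslov_derivative:
  assumes "suslov_solution J W \<Lambda>"
  obtains W' where "\<And>t. (W has_vector_derivative W' t) (at t)" "\<And>t. W' t $ 3 = 0"
    "\<And>t. J *v W' t = cross3 (J *v W t) (W t) + \<Lambda> t *\<^sub>R e3"
proof -
  obtain W' where W': "\<And>t. (W has_vector_derivative W' t) (at t)"
      "\<And>t. J *v W' t = cross3 (J *v W t) (W t) + \<Lambda> t *\<^sub>R e3"
    using assms unfolding suslov_solution_def by metis
  have "W' t $ 3 = 0" for t
  proof -
    have "((\<lambda>t. W t $ 3) has_vector_derivative W' t $ 3) (at t)"
      by (intro bounded_linear.has_vector_derivative[OF bounded_linear_vec_nth] W')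
    moreover have "(\<lambda>t. W t $ 3) = (\<lambda>t. 0)"
      using assms unfolding suslov_solution_def by auto
    ultimately show ?thesis
      by (metis has_vector_derivative_const vector_derivative_unique_at)
  qed
  with W' show ?thesis using that by blast
qed

lemma inner_e3: "e3 \<bullet> x = x $ 3" "x \<bullet> e3 = x $ 3"
  by (simp_all add: e3_def inner_axis inner_axis')

text \<open>Paired with \<open>W t\<close>, the cross product vanishes by orthogonality and the
  multiplier term by the constraint.\<close>

lemma suslov_energy:
  assumes J: "inertia_tensor J" and W: "suslov_solution J W \<Lambda>"
  shows "(J *v W t) \<bullet> W t = (J *v W s) \<bullet> W s"
proof -
  obtain W' where W': "\<And>t. (W has_vector_derivative W' t) (at t)"
    "\<And>t. J *v W' t = cross3 (J *v W t) (W t) + \<Lambda> t *\<^sub>R e3"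
    using suslov_derivative[OF W] by metis
  have 0: "(J *v W' t) \<bullet> W t = 0" for t
    using W by (simp add: W' inner_add_left inner_e3 suslov_solution_def dot_cross_self)
  have "((\<lambda>t. (J *v W t) \<bullet> W t) has_vector_derivative ((J *v W t) \<bullet> W' t + (J *v W' t) \<bullet> W t)) (at t)" for t
    by (intro bounded_bilinear.has_vector_derivative[OF bounded_bilinear_inner] W'
            bounded_linear.has_vector_derivative[OF matrix_vector_mul_bounded_linear])
  then have "((\<lambda>t. (J *v W t) \<bullet> W t) has_real_derivative 0) (at t)" for t
    using inertia_symmetric[OF J, of "W t" "W' t" for t]
    by (simp add: 0 has_real_derivative_iff_has_vector_derivative)
  then show ?thesis by (intro DERIV_isconst_all) auto
qed

text \<open>Pair the equation with \<open>W'\<close>: the multiplier disappears, so it need not be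
  estimated, and coercivity gives a bound quadratic in \<open>B\<close>. The constant depends on
  \<open>J\<close> alone.\<close>

lemma suslov_derivative_bound:
  assumes J: "inertia_tensor J"
  obtains L where "L \<ge> 0" "\<And>W \<Lambda> B. suslov_solution J W \<Lambda> \<Longrightarrow> (\<And>t. norm (W t) \<le> B) \<Longrightarrow>
    \<exists>W'. \<forall>t. (W has_vector_derivative W' t) (at t) \<and> norm (W' t) \<le> L * B\<^sup>2"
proof -
  obtain c where c: "c > 0" "\<And>x. c * (norm x)\<^sup>2 \<le> (J *v x) \<bullet> x"
    using inertia_coercive[OF J] by blast
  obtain M where M: "M \<ge> 0" "\<And>x. norm (J *v x) \<le> norm x * M"
    using bounded_linear.nonneg_bounded[OF matrix_vector_mul_bounded_linear, of J] by blast
  have "\<exists>W'. \<forall>t. (W has_vector_derivative W' t) (at t) \<and> norm (W' t) \<le> (M / c) * B\<^sup>2"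
    if W: "suslov_solution J W \<Lambda>" and B: "\<And>t. norm (W t) \<le> B" for W \<Lambda> B
  proof -
    obtain W' where W': "\<And>t. (W has_vector_derivative W' t) (at t)" "\<And>t. W' t $ 3 = 0"
      "\<And>t. J *v W' t = cross3 (J *v W t) (W t) + \<Lambda> t *\<^sub>R e3"
      using suslov_derivative[OF W] by metis
    have "norm (W' t) \<le> (M / c) * B\<^sup>2" for t
    proof -
      have "norm (cross3 (J *v W t) (W t)) \<le> norm (J *v W t) * norm (W t)"
        by (rule power2_le_imp_le) (use norm_cross[of "J *v W t" "W t"] in \<open>auto simp: power_mult_distrib\<close>)
      also have "\<dots> \<le> (B * M) * B"
        using B[of t] M order_trans[OF norm_ge_zero B]
        by (intro mult_mono order_trans[OF M(2)] mult_right_mono) auto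
      finally have cr: "norm (cross3 (J *v W t) (W t)) \<le> M * B\<^sup>2" by (simp add: power2_eq_square ac_simps)
      have "c * (norm (W' t))\<^sup>2 \<le> (J *v W' t) \<bullet> W' t" by (rule c)
      also have "\<dots> = cross3 (J *v W t) (W t) \<bullet> W' t"
        by (simp add: W'(2,3) inner_add_left inner_e3)
      also have "\<dots> \<le> norm (cross3 (J *v W t) (W t)) * norm (W' t)" by (rule norm_cauchy_schwarz)
      also have "\<dots> \<le> (M * B\<^sup>2) * norm (W' t)" by (intro mult_right_mono cr) simp
      finally have "(c * norm (W' t)) * norm (W' t) \<le> (M * B\<^sup>2) * norm (W' t)"
        by (simp add: power2_eq_square ac_simps)
      then have "c * norm (W' t) \<le> M * B\<^sup>2 \<or> norm (W' t) = 0"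
        by (metis mult_le_cancel_right norm_le_zero_iff norm_eq_zero not_le)
      then show ?thesis using c(1) M(1) by (auto simp: field_simps)
    qed
    with W'(1) show ?thesis by blast
  qed
  then show ?thesis using that[of "M / c"] c(1) M(1) by auto
qed

section \<open>One-step error of the Cayley reconstruction\<close>

lemma bounded_vector_derivative_lipschitz:
  fixes a b :: real
  assumes f: "\<And>x. (f has_vector_derivative f' x) (at x)" and L: "\<And>x. norm (f' x) \<le> L"
  shows "norm (f b - f a) \<le> L * \<bar>b - a\<bar>"
proof -
  have "norm (f b - f a) \<le> L * norm (b - a)"
  proof (rule differentiable_bound[of UNIV])
    show "(f has_derivative (\<lambda>h. h *\<^sub>R f' x)) (at x within UNIV)" for x
      using f[of x] by (simp add: has_vector_derivative_def)
    show "onorm (\<lambda>h. h *\<^sub>R f' x) \<le> L" for x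
      using L[of x] by (intro onorm_le) (simp add: mult_mono mult.commute[of L])
  qed auto
  then show ?thesis by simp
qed

text \<open>\<open>K\<close> is chosen after \<open>J\<close> and \<open>B\<close> but before the
  solution, the time and the step size; this is the source of uniformity in \<open>k\<close>. Exact
  and discrete steps are both compared with the Euler step.\<close>

lemma reconstruction_error:
  assumes J: "inertia_tensor J"
  obtains K where "\<And>X W \<Lambda> t \<epsilon>. (\<And>t. X t \<in> SO3) \<Longrightarrow>
    (\<And>t. (X has_vector_derivative X t ** hat (W t)) (at t)) \<Longrightarrow> suslov_solution J W \<Lambda> \<Longrightarrow>
    (\<And>t. norm (W t) \<le> B) \<Longrightarrow> 0 \<le> \<epsilon> \<Longrightarrow>
    SO3_dist (X (t + \<epsilon>)) (X t ** cay (\<epsilon> *\<^sub>R hat (W t))) \<le> K * \<epsilon>\<^sup>2"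
proof -
  obtain L where L: "L \<ge> 0" "\<And>W \<Lambda> B. suslov_solution J W \<Lambda> \<Longrightarrow> (\<And>t. norm (W t) \<le> B) \<Longrightarrow>
    \<exists>W'. \<forall>t. (W has_vector_derivative W' t) (at t) \<and> norm (W' t) \<le> L * B\<^sup>2"
    using suslov_derivative_bound[OF J] by metis
  obtain K where K: "K \<ge> 0" "\<And>(a::real^3^3) (b::real^3^3). norm (a ** b) \<le> norm a * norm b * K"
    using mmult.nonneg_bounded by blast
  obtain H where H: "H \<ge> 0" "\<And>w. norm (hat w) \<le> norm w * H"
    using bounded_linear.nonneg_bounded[OF bounded_linear_hat] by blast
  obtain K1 where K1: "K1 \<ge> 0" "\<And>A B. B \<in> SO3 \<Longrightarrow> SO3_dist A B \<le> K1 * norm (A - B)"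
    using SO3_dist_le_norm by metis
  obtain K2 where K2: "K2 \<ge> 0" "\<And>w. norm (cay (hat w) - mat 1 - hat w) \<le> K2 * (norm w)\<^sup>2"
    using cay_error by metis
  \<comment> \<open>Bounds the second derivative of \<open>X\<close>, which is
    \<open>X t ** hat (W' t) + V t ** hat (W t)\<close>.\<close>
  define L2 where "L2 = sqrt 3 * ((L * B\<^sup>2) * H) * K + (sqrt 3 * (B * H) * K) * (B * H) * K"
  have "SO3_dist (X (t + \<epsilon>)) (X t ** cay (\<epsilon> *\<^sub>R hat (W t))) \<le> (K1 * (L2 + sqrt 3 * (K2 * B\<^sup>2) * K)) * \<epsilon>\<^sup>2"
    if X: "\<And>t. X t \<in> SO3" and dX: "\<And>t. (X has_vector_derivative X t ** hat (W t)) (at t)"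
      and W: "suslov_solution J W \<Lambda>" and B: "\<And>t. norm (W t) \<le> B" and \<epsilon>: "0 \<le> \<epsilon>" for X W \<Lambda> t \<epsilon>
  proof -
    obtain W' where W': "\<And>t. (W has_vector_derivative W' t) (at t)" "\<And>t. norm (W' t) \<le> L * B\<^sup>2"
      using L(2)[OF W B] by blast
    have B0: "B \<ge> 0" using order_trans[OF norm_ge_zero B] .
    have nW: "norm (hat (W t)) \<le> B * H" for t
      by (rule order_trans[OF H(2)]) (intro mult_right_mono B H)
    have nW': "norm (hat (W' t)) \<le> (L * B\<^sup>2) * H" for t
      by (rule order_trans[OF H(2)]) (intro mult_right_mono W' H)
    define V where "V t = X t ** hat (W t)" for t
    have nV: "norm (V t) \<le> sqrt 3 * (B * H) * K" for t
      unfolding V_def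
      by (rule order_trans[OF K(2)]) (intro mult_right_mono mult_mono nW K; simp add: norm_SO3[OF X])
    define V' where "V' t = X t ** hat (W' t) + V t ** hat (W t)" for t
    have dV: "(V has_vector_derivative V' t) (at t)" for t
      unfolding V_def V'_def
      by (intro mmult.has_vector_derivative dX bounded_linear.has_vector_derivative[OF bounded_linear_hat] W')
    have nV': "norm (V' t) \<le> L2" for t
      unfolding V'_def L2_def
    proof (intro order_trans[OF norm_triangle_ineq] add_mono)
      show "norm (X t ** hat (W' t)) \<le> sqrt 3 * (L * B\<^sup>2 * H) * K"
        by (rule order_trans[OF K(2)]) (intro mult_right_mono mult_mono nW' K; simp add: norm_SO3[OF X])
      show "norm (V t ** hat (W t)) \<le> sqrt 3 * (B * H) * K * (B * H) * K"
        by (rule order_trans[OF K(2)]) (intro mult_right_mono mult_mono nW nV K; simp add: B0 H K)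
    qed
    have L2: "L2 \<ge> 0" using order_trans[OF norm_ge_zero nV'] .
    have "norm (V x - V t) \<le> L2 * \<epsilon>" if "x \<in> {t..t + \<epsilon>}" for x
    proof -
      have "norm (V x - V t) \<le> L2 * \<bar>x - t\<bar>"
        by (rule bounded_vector_derivative_lipschitz[OF dV nV'])
      also have "\<dots> \<le> L2 * \<epsilon>" using that L2 by (intro mult_left_mono) auto
      finally show ?thesis .
    qed
    then have "norm (X (t + \<epsilon>) - X t - (t + \<epsilon> - t) *\<^sub>R V t) \<le> norm (t + \<epsilon> - t) * (L2 * \<epsilon>)"
      using \<epsilon> dX by (intro vector_differentiable_bound_linearization[where S="{t..t+\<epsilon>}"])
        (auto simp: V_def closed_segment_eq_real_ivl intro: has_vector_derivative_at_within)
    then have 1: "norm (X (t + \<epsilon>) - X t - \<epsilon> *\<^sub>R V t) \<le> L2 * \<epsilon>\<^sup>2"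
      using \<epsilon> by (simp add: power2_eq_square ac_simps)
    define C where "C = cay (hat (\<epsilon> *\<^sub>R W t))"
    have C: "C \<in> SO3" unfolding C_def by (rule cay_SO3)
    have "norm (C - mat 1 - hat (\<epsilon> *\<^sub>R W t)) \<le> K2 * (norm (\<epsilon> *\<^sub>R W t))\<^sup>2"
      unfolding C_def by (rule K2)
    also have "\<dots> \<le> K2 * (\<epsilon> * B)\<^sup>2"
      using \<epsilon> B[of t] K2(1) by (intro mult_left_mono power_mono) (auto intro: mult_left_mono)
    finally have nC: "norm (C - mat 1 - hat (\<epsilon> *\<^sub>R W t)) \<le> K2 * (\<epsilon> * B)\<^sup>2" .
    have "norm (X t ** (C - mat 1 - hat (\<epsilon> *\<^sub>R W t))) \<le> sqrt 3 * (K2 * (\<epsilon> * B)\<^sup>2) * K"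
      by (rule order_trans[OF K(2)]) (intro mult_right_mono mult_mono nC K; simp add: norm_SO3[OF X])
    moreover have "X t ** (C - mat 1 - hat (\<epsilon> *\<^sub>R W t)) = X t ** C - X t - \<epsilon> *\<^sub>R V t"
      by (simp add: mmult.diff_right hat_simps mmult.scaleR_right V_def)
    ultimately have 2: "norm (X t ** C - X t - \<epsilon> *\<^sub>R V t) \<le> sqrt 3 * (K2 * B\<^sup>2) * K * \<epsilon>\<^sup>2"
      by (simp add: power_mult_distrib ac_simps)
    have "X (t + \<epsilon>) - X t ** C = (X (t + \<epsilon>) - X t - \<epsilon> *\<^sub>R V t) - (X t ** C - X t - \<epsilon> *\<^sub>R V t)"
      by simp
    then have "norm (X (t + \<epsilon>) - X t ** C) \<le> (L2 + sqrt 3 * (K2 * B\<^sup>2) * K) * \<epsilon>\<^sup>2"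
      using order_trans[OF norm_triangle_ineq4 add_mono[OF 1 2]] by (simp add: algebra_simps)
    with K1(2)[OF SO3_mult[OF X C], of "X (t + \<epsilon>)" t] K1(1)
    have "SO3_dist (X (t + \<epsilon>)) (X t ** C) \<le> K1 * ((L2 + sqrt 3 * (K2 * B\<^sup>2) * K) * \<epsilon>\<^sup>2)"
      by (meson mult_left_mono order_trans)
    then show ?thesis by (simp add: C_def hat_simps mult.assoc)
  qed
  then show ?thesis using that by blast
qed

text \<open>A discrete Gronwall argument: the exact flow conserves the energy \<open>E\<close>, and a one-step error
  of order at least one multiplies \<open>1 + E\<close> by at most \<open>1 + A \<epsilon>\<close>.\<close>

lemma error_O_bounded_solutions:
  assumes J: "inertia_tensor J" and N: "bounded_horizon N"
    and w0: "\<And>\<epsilon>. \<epsilon> > 0 \<Longrightarrow> w \<epsilon> 0 = w0"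
    and W: "\<And>\<epsilon> k. \<epsilon> > 0 \<Longrightarrow> k < N \<epsilon> \<Longrightarrow> suslov_solution J (W \<epsilon> k) (\<Lambda> \<epsilon> k) \<and> W \<epsilon> k (real k * \<epsilon>) = w \<epsilon> k"
    and err: "error_O (p + 1) N (\<lambda>\<epsilon> k. norm (W \<epsilon> k (real k * \<epsilon> + \<epsilon>) - w \<epsilon> (Suc k)))"
  obtains B where "\<forall>\<^sub>F \<epsilon> in at_right 0. \<forall>k < N \<epsilon>. \<forall>t. norm (W \<epsilon> k t) \<le> B"
proof -
  obtain c where c: "c > 0" "\<And>x. c * (norm x)\<^sup>2 \<le> (J *v x) \<bullet> x"
    using inertia_coercive[OF J] by blast
  obtain M where M: "M \<ge> 0" "\<And>x. norm (J *v x) \<le> norm x * M"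
    using bounded_linear.nonneg_bounded[OF matrix_vector_mul_bounded_linear, of J] by blast
  obtain T where T: "\<forall>\<^sub>F \<epsilon> in at_right 0. real (N \<epsilon>) * \<epsilon> \<le> T"
    using N unfolding bounded_horizon_def by blast
  obtain C0 where C0: "\<forall>\<^sub>F \<epsilon> in at_right 0. \<forall>k < N \<epsilon>.
      \<bar>norm (W \<epsilon> k (real k * \<epsilon> + \<epsilon>) - w \<epsilon> (Suc k))\<bar> \<le> C0 * \<epsilon> ^ (p + 1)"
    using err unfolding error_O_def by blast
  \<comment> \<open>The sign of \<open>C0\<close> is unknown; a nonnegative constant keeps the
    products below monotone.\<close>
  define C where "C = max C0 0"
  define E where "E x = (J *v x) \<bullet> x" for x
  have E0: "E x \<ge> 0" for x unfolding E_def using c(2)[of x] c(1)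
    by (meson order_trans mult_nonneg_nonneg less_imp_le zero_le_power2)
  \<comment> \<open>The first two summands come from the cross term of the energy increment, after
    bounding \<open>norm y\<close> by the energy; the last comes from the quadratic term.\<close>
  define A where "A = M * C + M * C / c + M * C\<^sup>2"
  have A: "A \<ge> 0" using M c by (simp add: A_def C_def)
  define F where "F = (1 + E w0) * exp (A * T)"
  \<comment> \<open>Below step size 1, higher powers of \<open>\<epsilon>\<close> are absorbed into
    \<open>\<epsilon>\<close>.\<close>
  have ev: "\<forall>\<^sub>F \<epsilon> in at_right 0. \<epsilon> < (1::real)"
    using eventually_at_right_real[of 0 1] by (auto elim: eventually_mono)
  have "\<forall>\<^sub>F \<epsilon> in at_right 0. \<forall>k < N \<epsilon>. \<forall>t. norm (W \<epsilon> k t) \<le> sqrt (F / c)"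
    using T C0 ev eventually_at_right_less[of 0]
  proof eventually_elim
    case (elim \<epsilon>)
    note \<epsilon> = \<open>0 < \<epsilon>\<close> \<open>\<epsilon> < 1\<close>
    have step: "1 + E (w \<epsilon> (Suc k)) \<le> (1 + E (w \<epsilon> k)) * (1 + A * \<epsilon>)" if k: "k < N \<epsilon>" for k
    proof -
      define y where "y = W \<epsilon> k (real k * \<epsilon> + \<epsilon>)"
      define \<delta> where "\<delta> = w \<epsilon> (Suc k) - y"
      have Ey: "E y = E (w \<epsilon> k)"
        using W[OF \<epsilon>(1) k] suslov_energy[OF J, of "W \<epsilon> k" "\<Lambda> \<epsilon> k" "real k * \<epsilon> + \<epsilon>" "real k * \<epsilon>"]
        by (simp add: E_def y_def)
      have "norm \<delta> \<le> C0 * \<epsilon> ^ (p + 1)"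
        using elim(2) k by (simp add: \<delta>_def y_def norm_minus_commute)
      also have "\<dots> \<le> C * \<epsilon> ^ (p + 1)" using \<epsilon> by (intro mult_right_mono) (auto simp: C_def)
      also have "\<dots> \<le> C * \<epsilon>"
        using \<epsilon> power_decreasing[of 1 "p + 1" \<epsilon>] by (intro mult_left_mono) (auto simp: C_def)
      finally have d: "norm \<delta> \<le> C * \<epsilon>" .
      have "c * (2 * norm y) \<le> c * (1 + (norm y)\<^sup>2)"
        using c(1) sum_squares_bound[of 1 "norm y"] by (intro mult_left_mono) auto
      also have "\<dots> \<le> c + E y" using c(2)[of y] by (simp add: E_def algebra_simps)
      finally have ny: "2 * norm y \<le> 1 + E y / c" using c(1) by (simp add: field_simps)
      have "\<bar>(J *v y) \<bullet> \<delta>\<bar> \<le> norm (J *v y) * norm \<delta>" by (rule Cauchy_Schwarz_ineq2)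
      also have "\<dots> \<le> (norm y * M) * (C * \<epsilon>)" using M d by (intro mult_mono) auto
      finally have 1: "2 * ((J *v y) \<bullet> \<delta>) \<le> (2 * norm y) * (M * C * \<epsilon>)" by (simp add: ac_simps)
      also have "\<dots> \<le> (1 + E y / c) * (M * C * \<epsilon>)"
        using ny M \<epsilon> by (intro mult_right_mono) (auto simp: C_def)
      finally have 1: "2 * ((J *v y) \<bullet> \<delta>) \<le> (1 + E y / c) * (M * C * \<epsilon>)" .
      have "(J *v \<delta>) \<bullet> \<delta> \<le> norm (J *v \<delta>) * norm \<delta>" by (rule norm_cauchy_schwarz)
      also have "\<dots> \<le> (norm \<delta> * M) * norm \<delta>" using M by (intro mult_right_mono) auto
      also have "\<dots> \<le> (C * \<epsilon> * M) * (C * \<epsilon>)" using M d \<epsilon> by (intro mult_mono mult_right_mono) (auto simp: C_def)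
      also have "\<dots> = M * C\<^sup>2 * \<epsilon> * \<epsilon>" by (simp add: power2_eq_square ac_simps)
      also have "\<dots> \<le> M * C\<^sup>2 * \<epsilon> * 1" using M \<epsilon> by (intro mult_left_mono) auto
      finally have 2: "(J *v \<delta>) \<bullet> \<delta> \<le> M * C\<^sup>2 * \<epsilon>" by simp
      have "w \<epsilon> (Suc k) = y + \<delta>" by (simp add: \<delta>_def)
      then have "E (w \<epsilon> (Suc k)) = E y + 2 * ((J *v y) \<bullet> \<delta>) + (J *v \<delta>) \<bullet> \<delta>"
        using inertia_symmetric[OF J, of \<delta> y]
        by (simp add: E_def matrix_vector_right_distrib inner_add_left inner_add_right)
      with 1 2 have "E (w \<epsilon> (Suc k)) \<le> E y + (1 + E y / c) * (M * C * \<epsilon>) + M * C\<^sup>2 * \<epsilon>" by linarith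
      \<comment> \<open>Nonnegative terms are added so that the bound factors into a product that
        can be iterated.\<close>
      also have "\<dots> \<le> E y + (1 + E y / c) * (M * C * \<epsilon>) + M * C\<^sup>2 * \<epsilon>
          + \<epsilon> * (M * C / c + E y * (M * C) + E y * (M * C\<^sup>2))"
        using \<epsilon> M c E0[of y] by (simp add: C_def)
      also have "\<dots> = (1 + E y) * (1 + A * \<epsilon>) - 1" by (simp add: A_def algebra_simps add_divide_distrib)
      finally show ?thesis by (simp add: Ey)
    qed
    have growth: "1 + E (w \<epsilon> k) \<le> (1 + E w0) * (1 + A * \<epsilon>) ^ k" if "k \<le> N \<epsilon>" for k
      using that
    proof (induction k)
      case 0
      then show ?case using w0 \<epsilon> by simp
    next
      case (Suc k)
      then have "1 + E (w \<epsilon> (Suc k)) \<le> (1 + E (w \<epsilon> k)) * (1 + A * \<epsilon>)" by (intro step) auto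
      also have "\<dots> \<le> ((1 + E w0) * (1 + A * \<epsilon>) ^ k) * (1 + A * \<epsilon>)"
        using Suc A \<epsilon> by (intro mult_right_mono) auto
      finally show ?case by (simp add: ac_simps)
    qed
    show ?case
    proof (intro allI impI)
      fix k t assume k: "k < N \<epsilon>"
      \<comment> \<open>The bounded horizon keeps the accumulated growth factor independent of the
        step size.\<close>
      have "(1 + A * \<epsilon>) ^ k \<le> exp (A * \<epsilon>) ^ k"
        using A \<epsilon> by (intro power_mono exp_ge_add_one_self) auto
      also have "\<dots> = exp (A * (real k * \<epsilon>))" by (simp add: exp_of_nat_mult[symmetric] ac_simps)
      also have "\<dots> \<le> exp (A * T)"
      proof -
        have "real k * \<epsilon> \<le> real (N \<epsilon>) * \<epsilon>" using k \<epsilon> by (intro mult_right_mono) auto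
        then show ?thesis using elim(1) A by (simp add: mult_left_mono)
      qed
      finally have "(1 + E w0) * (1 + A * \<epsilon>) ^ k \<le> F"
        unfolding F_def using E0[of w0] by (intro mult_left_mono) auto
      with growth[of k] k have "E (w \<epsilon> k) \<le> F" by simp
      \<comment> \<open>Conservation carries the bound at the grid point to all times of the exact
        solution.\<close>
      moreover have "E (W \<epsilon> k t) = E (w \<epsilon> k)"
        using W[OF \<epsilon>(1) k] suslov_energy[OF J, of "W \<epsilon> k" "\<Lambda> \<epsilon> k" t "real k * \<epsilon>"]
        by (simp add: E_def)
      ultimately have "c * (norm (W \<epsilon> k t))\<^sup>2 \<le> F" using c(2)[of "W \<epsilon> k t"] by (simp add: E_def)
      then have "(norm (W \<epsilon> k t))\<^sup>2 \<le> F / c" using c(1) by (simp add: field_simps)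
      then show "norm (W \<epsilon> k t) \<le> sqrt (F / c)" by (rule real_le_rsqrt)
    qed
  qed
  then show ?thesis using that by blast
qed

section \<open>Transfer of the integrator estimates to SO(3)\<close>

theorem proposition5p1:
  fixes J :: "real^3^3" and N :: "real \<Rightarrow> nat" and p s :: nat
    and w :: "real \<Rightarrow> nat \<Rightarrow> real^3" and lam :: "real \<Rightarrow> nat \<Rightarrow> real"
    and R v :: "real \<Rightarrow> nat \<Rightarrow> real^3^3"
  assumes "inertia_tensor J"
    and "bounded_horizon N"
    and "suslov_integrator J N p s w lam"
    and "\<exists>R0 \<in> SO3. \<forall>\<epsilon>>0. R \<epsilon> 0 = R0"
    and "\<forall>\<epsilon>>0. \<forall>k < N \<epsilon>. R \<epsilon> (Suc k) = R \<epsilon> k ** cay (\<epsilon> *\<^sub>R hat (w \<epsilon> k))"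
    and "\<forall>\<epsilon>>0. \<forall>k \<le> N \<epsilon>. v \<epsilon> k = R \<epsilon> k ** hat (w \<epsilon> k)"
  shows "unreduced_integrator J N (min 1 p) s R v lam"
proof -
  note J = assms(1)
  obtain w0 where w0: "\<And>\<epsilon>. \<epsilon> > 0 \<Longrightarrow> w \<epsilon> 0 = w0"
    using assms(3) unfolding suslov_integrator_def by auto
  have w3: "w \<epsilon> k $ 3 = 0" if "\<epsilon> > 0" "k < N \<epsilon>" for \<epsilon> k
    using assms(3) that unfolding suslov_integrator_def by auto
  obtain R0 where R0: "R0 \<in> SO3" "\<And>\<epsilon>. \<epsilon> > 0 \<Longrightarrow> R \<epsilon> 0 = R0" using assms(4) by auto
  have Rstep: "R \<epsilon> (Suc k) = R \<epsilon> k ** cay (\<epsilon> *\<^sub>R hat (w \<epsilon> k))" if "\<epsilon> > 0" "k < N \<epsilon>" for \<epsilon> k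
    using assms(5) that by blast
  have v: "v \<epsilon> k = R \<epsilon> k ** hat (w \<epsilon> k)" if "\<epsilon> > 0" "k \<le> N \<epsilon>" for \<epsilon> k
    using assms(6) that by blast
  have RS: "R \<epsilon> k \<in> SO3" if "\<epsilon> > 0" "k \<le> N \<epsilon>" for \<epsilon> k
    using that(2)
  proof (induction k)
    case (Suc k)
    then show ?case using that(1) cay_SO3[of "\<epsilon> *\<^sub>R w \<epsilon> k"] by (simp add: Rstep SO3_mult hat_simps)
  qed (use R0 that in simp)
  have errors: "error_O (1 + 1) N (\<lambda>\<epsilon> k. SO3_dist (X \<epsilon> k (real k * \<epsilon> + \<epsilon>)) (R \<epsilon> (Suc k))) \<and>
      error_O (p + 1) N
            (\<lambda>\<epsilon> k. so3_norm (matrix_inv (X \<epsilon> k (real k * \<epsilon> + \<epsilon>)) ** V \<epsilon> k (real k * \<epsilon> + \<epsilon>)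
                            - matrix_inv (R \<epsilon> (Suc k)) ** v \<epsilon> (Suc k))) \<and>
      error_O (s + 1) N (\<lambda>\<epsilon> k. \<Lambda> \<epsilon> k (real k * \<epsilon> + \<epsilon>) - lam \<epsilon> (Suc k))"
    if sol: "\<forall>\<epsilon>>0. \<forall>k < N \<epsilon>. unreduced_solution J (X \<epsilon> k) (V \<epsilon> k) (\<Lambda> \<epsilon> k) \<and>
              X \<epsilon> k (real k * \<epsilon>) = R \<epsilon> k \<and> V \<epsilon> k (real k * \<epsilon>) = v \<epsilon> k" for X V \<Lambda>
  proof -
    define W where "W \<epsilon> k = angular_velocity (X \<epsilon> k) (V \<epsilon> k)" for \<epsilon> k
    have usol: "unreduced_solution J (X \<epsilon> k) (V \<epsilon> k) (\<Lambda> \<epsilon> k)" "X \<epsilon> k (real k * \<epsilon>) = R \<epsilon> k"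
        "V \<epsilon> k (real k * \<epsilon>) = v \<epsilon> k" if "\<epsilon> > 0" "k < N \<epsilon>" for \<epsilon> k
      using sol that by blast+
    have W: "suslov_solution J (W \<epsilon> k) (\<Lambda> \<epsilon> k) \<and> W \<epsilon> k (real k * \<epsilon>) = w \<epsilon> k"
      if "\<epsilon> > 0" "k < N \<epsilon>" for \<epsilon> k
      using unreduced_imp_suslov[OF J usol(1)[OF that]] angular_velocity_eqI usol(2,3)[OF that]
        RS[of \<epsilon> k] v[of \<epsilon> k] that by (simp add: W_def)
    \<comment> \<open>The Suslov estimates hold for every family of exact solutions through the
      \<open>w\<close>, in particular for the reduced family \<open>W\<close>.\<close>
    have serr: "error_O (p + 1) N
          (\<lambda>\<epsilon> k. so3_norm (hat (W \<epsilon> k (real k * \<epsilon> + \<epsilon>)) - hat (w \<epsilon> (Suc k)))) \<and>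
        error_O (s + 1) N (\<lambda>\<epsilon> k. \<Lambda> \<epsilon> k (real k * \<epsilon> + \<epsilon>) - lam \<epsilon> (Suc k))"
      using assms(3)[unfolded suslov_integrator_def] W by blast
    then have werr: "error_O (p + 1) N (\<lambda>\<epsilon> k. norm (W \<epsilon> k (real k * \<epsilon> + \<epsilon>) - w \<epsilon> (Suc k)))"
      by (simp add: so3_norm_hat flip: hat_simps)
    obtain B where B: "\<forall>\<^sub>F \<epsilon> in at_right 0. \<forall>k < N \<epsilon>. \<forall>t. norm (W \<epsilon> k t) \<le> B"
      using error_O_bounded_solutions[OF J assms(2) w0 W werr] by blast
    obtain K where K: "\<And>X W \<Lambda> t \<epsilon>. (\<And>t. X t \<in> SO3) \<Longrightarrow>
        (\<And>t. (X has_vector_derivative X t ** hat (W t)) (at t)) \<Longrightarrow> suslov_solution J W \<Lambda> \<Longrightarrow>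
        (\<And>t. norm (W t) \<le> B) \<Longrightarrow> 0 \<le> \<epsilon> \<Longrightarrow>
        SO3_dist (X (t + \<epsilon>)) (X t ** cay (\<epsilon> *\<^sub>R hat (W t))) \<le> K * \<epsilon>\<^sup>2"
      using reconstruction_error[OF J] by metis
    have "\<forall>\<^sub>F \<epsilon> in at_right 0. \<forall>k < N \<epsilon>.
        \<bar>SO3_dist (X \<epsilon> k (real k * \<epsilon> + \<epsilon>)) (R \<epsilon> (Suc k))\<bar> \<le> K * \<epsilon> ^ (1 + 1)"
      using B eventually_at_right_less[of 0]
    proof eventually_elim
      case (elim \<epsilon>)
      show ?case
      proof (intro allI impI)
        fix k assume k: "k < N \<epsilon>"
        note u = usol[OF elim(2) k]
        have "SO3_dist (X \<epsilon> k (real k * \<epsilon> + \<epsilon>))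
            (X \<epsilon> k (real k * \<epsilon>) ** cay (\<epsilon> *\<^sub>R hat (W \<epsilon> k (real k * \<epsilon>)))) \<le> K * \<epsilon>\<^sup>2"
        proof (rule K)
          show "suslov_solution J (W \<epsilon> k) (\<Lambda> \<epsilon> k)" using W elim k by blast
          show "(X \<epsilon> k has_vector_derivative X \<epsilon> k t ** hat (W \<epsilon> k t)) (at t)" for t
            using unreduced_velocity(2,3)[OF u(1), of t] by (simp add: W_def)
        qed (use elim k unreduced_velocity(1)[OF u(1)] in auto)
        then show "\<bar>SO3_dist (X \<epsilon> k (real k * \<epsilon> + \<epsilon>)) (R \<epsilon> (Suc k))\<bar> \<le> K * \<epsilon> ^ (1 + 1)"
          using W[OF elim(2) k] u Rstep[OF elim(2) k] by (simp add: SO3_dist_def power2_eq_square)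
      qed
    qed
    then have 1: "error_O (1 + 1) N (\<lambda>\<epsilon> k. SO3_dist (X \<epsilon> k (real k * \<epsilon> + \<epsilon>)) (R \<epsilon> (Suc k)))"
      unfolding error_O_def by blast
    \<comment> \<open>Left trivialization identifies the two velocity errors. For
      \<open>k < N \<epsilon>\<close> the index \<open>Suc k\<close> is at most
      \<open>N \<epsilon>\<close>, where \<open>v\<close> is still given by the
      reconstruction.\<close>
    have eq: "matrix_inv (X \<epsilon> k t) ** V \<epsilon> k t - matrix_inv (R \<epsilon> (Suc k)) ** v \<epsilon> (Suc k)
        = hat (W \<epsilon> k t) - hat (w \<epsilon> (Suc k))" if "\<epsilon> > 0" "k < N \<epsilon>" for \<epsilon> k t
      using unreduced_velocity(1,3)[OF usol(1)[OF that], of t] RS[of \<epsilon> "Suc k"] v[of \<epsilon> "Suc k"] that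
      by (simp add: matrix_inv_SO3 W_def matrix_mul_assoc SO3_iff)
    obtain C where "\<forall>\<^sub>F \<epsilon> in at_right 0. \<forall>k < N \<epsilon>.
        \<bar>so3_norm (hat (W \<epsilon> k (real k * \<epsilon> + \<epsilon>)) - hat (w \<epsilon> (Suc k)))\<bar> \<le> C * \<epsilon> ^ (p + 1)"
      using serr unfolding error_O_def by blast
    then have "\<forall>\<^sub>F \<epsilon> in at_right 0. \<forall>k < N \<epsilon>.
        \<bar>so3_norm (matrix_inv (X \<epsilon> k (real k * \<epsilon> + \<epsilon>)) ** V \<epsilon> k (real k * \<epsilon> + \<epsilon>)
                            - matrix_inv (R \<epsilon> (Suc k)) ** v \<epsilon> (Suc k))\<bar> \<le> C * \<epsilon> ^ (p + 1)"
      using eventually_at_right_less[of 0] by eventually_elim (simp add: eq)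
    then have 2: "error_O (p + 1) N
            (\<lambda>\<epsilon> k. so3_norm (matrix_inv (X \<epsilon> k (real k * \<epsilon> + \<epsilon>)) ** V \<epsilon> k (real k * \<epsilon> + \<epsilon>)
                            - matrix_inv (R \<epsilon> (Suc k)) ** v \<epsilon> (Suc k)))"
      unfolding error_O_def by blast
    show ?thesis by (intro conjI 1 2 conjunct2[OF serr])
  qed
  have init: "\<forall>\<epsilon>>0. R \<epsilon> 0 = R0 \<and> v \<epsilon> 0 = R0 ** hat w0"
    using R0 w0 v by simp
  have tan: "\<forall>\<epsilon>>0. \<forall>k \<le> N \<epsilon>. R \<epsilon> k \<in> SO3 \<and> v \<epsilon> k \<in> tangent_SO3 (R \<epsilon> k)"
    using RS v hat_so3 by (auto simp: tangent_SO3_def)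
  have con: "\<forall>\<epsilon>>0. \<forall>k < N \<epsilon>. v \<epsilon> k \<in> constraint_distribution (R \<epsilon> k)"
    using v w3 by (auto simp: constraint_distribution_def intro: less_imp_le)
  show ?thesis
    unfolding unreduced_integrator_def
  proof (intro conjI)
    show "\<exists>R0 v0. \<forall>\<epsilon>>0. R \<epsilon> 0 = R0 \<and> v \<epsilon> 0 = v0" using init by blast
    show "\<exists>r q. min r q = min 1 p \<and> (\<forall>X V \<Lambda>.
          (\<forall>\<epsilon>>0. \<forall>k < N \<epsilon>. unreduced_solution J (X \<epsilon> k) (V \<epsilon> k) (\<Lambda> \<epsilon> k) \<and>
              X \<epsilon> k (real k * \<epsilon>) = R \<epsilon> k \<and> V \<epsilon> k (real k * \<epsilon>) = v \<epsilon> k) \<longrightarrow>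
          error_O (r + 1) N
            (\<lambda>\<epsilon> k. SO3_dist (X \<epsilon> k (real k * \<epsilon> + \<epsilon>)) (R \<epsilon> (Suc k))) \<and>
          error_O (q + 1) N
            (\<lambda>\<epsilon> k. so3_norm (matrix_inv (X \<epsilon> k (real k * \<epsilon> + \<epsilon>)) ** V \<epsilon> k (real k * \<epsilon> + \<epsilon>)
                            - matrix_inv (R \<epsilon> (Suc k)) ** v \<epsilon> (Suc k))) \<and>
          error_O (s + 1) N (\<lambda>\<epsilon> k. \<Lambda> \<epsilon> k (real k * \<epsilon> + \<epsilon>) - lam \<epsilon> (Suc k)))"
      \<comment> \<open>The position has order 1 and the velocity keeps order \<open>p\<close>; for
        \<open>p \<ge> 1\<close> the minimum is 1.\<close>
      by (rule exI[of _ 1], rule exI[of _ p], rule conjI[OF refl], intro allI impI, rule errors)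
  qed (rule tan con)+
qed

end
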